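(* Let $q,a,b,c,d,e,f,h$ be non-zero complex numbers with $|q|<1$ and $|q^2a^2|<|bcdef|$, let $\sigma\in(0,\infty)$, $z=\mathrm e^{i\psi}$, and suppose $h\sqrt{\frac{def}{qa}}\notin\{q^k:k\in\mathbb Z\}$. Assume there are no vanishing denominator factors and that the denominator factors in the integrand have maximum modulus less than unity, i.e. $\big|\sigma\sqrt{\frac{def}{qa}}\big|$, $\big|\sigma\sqrt{\frac{qa}{def}}\big|$, $\big|\sqrt{\frac{qad}{ef}}\big|/\sigma$, $\big|\sqrt{\frac{qae}{df}}\big|/\sigma$, $\big|\sqrt{\frac{qaf}{de}}\big|/\sigma$, $\big|\frac{(qa)^{3/2}}{bc\sqrt{def}}\big|/\sigma$ are all $<1$. Then $${}_8W_7\!\left(a;b,c,d,e,f;q,\frac{q^2a^2}{bcdef}\right)=\frac{(q,qa,\frac{qa}{bc},\frac{qa}{de},\frac{qa}{df},\frac{qa}{ef},d,e,f;q)_\infty}{2\pi\,\vartheta(h,h\frac{def}{qa};q)\,(\frac{qa}b,\frac{qa}c,\frac{qa}d,\frac{qa}e,\frac{qa}f;q)_\infty}$$ $$\times\int_{-\pi}^{\pi}\frac{\left(\big(h\sqrt{\frac{def}{qa}},\frac qh\sqrt{\frac{qa}{def}}\big)\frac\sigma z,\ \big(h\sqrt{\frac{def}{qa}},\frac qh\sqrt{\frac{qa}{def}},\frac{(qa)^{3/2}}{b\sqrt{def}},\frac{(qa)^{3/2}}{c\sqrt{def}}\big)\frac z\sigma;q\right)_\infty}{\left(\big(\sqrt{\frac{def}{qa}},\sqrt{\frac{qa}{def}}\big)\frac\sigma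 z,\ \big(\sqrt{\frac{qad}{ef}},\sqrt{\frac{qae}{df}},\sqrt{\frac{qaf}{de}},\frac{(qa)^{3/2}}{bc\sqrt{def}}\big)\frac z\sigma;q\right)_\infty}\,\mathrm d\psi.$$
   Context: Notation. $(a;q)_k=\prod_{j=0}^{k-1}(1-aq^j)$, $(a;q)_\infty=\prod_{j\ge0}(1-aq^j)$, $(a_1,\dots,a_r;q)_k=\prod_j(a_j;q)_k$ for $k\in\mathbb N_0\cup\{\infty\}$. In a list, $\pm x$ stands for the two entries $x,-x$, and $(x_1,\dots,x_k)t$ stands for the entries $x_1t,\dots,x_kt$. The symbol $e$ is a parameter, not Euler's number (written $\mathrm e$). $\vartheta(x;q)=(x,q/x;q)_\infty$ for $x\ne0$, $\vartheta(x_1,\dots,x_k;q)=\prod_j\vartheta(x_j;q)$. ${}_{r+1}\phi_r(a_1,\dots,a_{r+1};b_1,\dots,b_r;q,z)=\sum_{k\ge0}\frac{(a_1,\dots,a_{r+1};q)_k}{(q,b_1,\dots,b_r;q)_k}z^k$ for $|z|<1$, and $${}_8W_7(a;b,c,d,e,f;q,z)={}_8\phi_7\!\left(a,\pm q\sqrt a,b,c,d,e,f;\pm\sqrt a,\tfrac{qa}b,\tfrac{qa}c,\tfrac{qa}d,\tfrac{qa}e,\tfrac{qa}f;q,z\right).$$ Square roots are chosen consistently: fix square roots of $q,a,d,e,f$ and define all half-integer powers of monomials multiplicatively from these. Convention "no vanishing denominator factors": every infinite $q$-shifted factorial and every theta function appearing in a denominator is non-zero (in particular $h,\,h\frac{def}{qa}\notin\{q^k:k\in\mathbb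 Z\}$), and no denominator parameter of any series lies in $\{q^{-k}:k\in\mathbb N_0\}$. *)

theory Defs
  imports "HOL-Analysis.Analysis"
begin

definition qpoch :: "complex \<Rightarrow> complex \<Rightarrow> nat \<Rightarrow> complex" where
  "qpoch a q k = (\<Prod>j<k. 1 - a * q ^ j)"

definition qpoch_inf :: "complex \<Rightarrow> complex \<Rightarrow> complex" where
  "qpoch_inf a q = (\<Prod>j. 1 - a * q ^ j)"

definition qpochs :: "complex list \<Rightarrow> complex \<Rightarrow> nat \<Rightarrow> complex" where
  "qpochs as q k = (\<Prod>a\<leftarrow>as. qpoch a q k)"

definition qpochs_inf :: "complex list \<Rightarrow> complex \<Rightarrow> complex" where
  "qpochs_inf as q = (\<Prod>a\<leftarrow>as. qpoch_inf a q)"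

definition qtheta :: "complex \<Rightarrow> complex \<Rightarrow> complex" where
  "qtheta x q = qpochs_inf [x, q / x] q"

definition qthetas :: "complex list \<Rightarrow> complex \<Rightarrow> complex" where
  "qthetas xs q = (\<Prod>x\<leftarrow>xs. qtheta x q)"

text \<open>The basic hypergeometric series with \<open>r + 1\<close> numerator parameters \<open>as\<close> and
  \<open>r\<close> denominator parameters \<open>bs\<close>; meaningful for \<open>norm z < 1\<close>.\<close>

definition qhyp :: "complex list \<Rightarrow> complex list \<Rightarrow> complex \<Rightarrow> complex \<Rightarrow> complex" where
  "qhyp as bs q z = (\<Sum>k. qpochs as q k / qpochs (q # bs) q k * z ^ k)"

text \<open>Both square roots of \<open>a\<close> occur symmetrically among the parameters, so the choice of the
  principal root here is immaterial.\<close>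

definition W87_denoms ::
  "complex \<Rightarrow> complex \<Rightarrow> complex \<Rightarrow> complex \<Rightarrow> complex \<Rightarrow> complex \<Rightarrow> complex \<Rightarrow> complex list" where
  "W87_denoms a b c d e f q =
     [csqrt a, - csqrt a, q * a / b, q * a / c, q * a / d, q * a / e, q * a / f]"

definition W87 ::
  "complex \<Rightarrow> complex \<Rightarrow> complex \<Rightarrow> complex \<Rightarrow> complex \<Rightarrow> complex \<Rightarrow> complex \<Rightarrow> complex \<Rightarrow> complex" where
  "W87 a b c d e f q z =
     qhyp [a, q * csqrt a, - (q * csqrt a), b, c, d, e, f] (W87_denoms a b c d e f q) q z"

end

theory Submission
  imports Defs "HOL-Complex_Analysis.Complex_Analysis"
begin

text \<open>Write \<open>(x)\<^sub>k\<close> and \<open>(x)\<^sub>\<infinity>\<close> for the \<open>q\<close>-shifted factorials, \<open>\<theta>\<close> for the theta function and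
\<open>c = def/(qa) = s\<^sup>2\<close>. In the variable \<open>w = z/(\<sigma>s)\<close>, which runs through a circle of radius
\<open>\<bar>\<rho>\<bar>\<close> with \<open>\<rho> = 1/(\<sigma>s)\<close>, the integrand becomes
\<open>\<theta>(h/w) \<theta>(hcw) (qaw/b, qaw/c)\<^sub>\<infinity> / (1/w, 1/(cw), dw, ew, fw, qaw/(bc))\<^sub>\<infinity>\<close>; its poles inside the circle are
the points \<open>q\<^sup>k\<close> and \<open>q\<^sup>k/c\<close>. The proof has three ingredients.

\<^item> The quotient of the integral by \<open>\<theta>(h) \<theta>(hc)\<close> does not depend on \<open>h\<close>
  (\<open>theta_mean_proportional\<close>). By Weierstrass' three-term relation \<open>theta_three_term\<close>, the
  difference of the integrands for \<open>h\<close> and \<open>g\<close>, cross-multiplied with these theta values, contains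
  the factor \<open>\<theta>(w) \<theta>(cw)\<close>, which cancels all the poles inside the circle.

\<^item> For \<open>h = qa/(de)\<close> one has \<open>hc = f\<close>, and the theta functions in the integrand cancel the factors
  with \<open>f\<close> so well that the integral is analytic in \<open>x = 1/f\<close> in a full disc around \<open>x = 0\<close>. So is
  the very-well-poised series times \<open>(qax)\<^sub>\<infinity>\<close>. At \<open>x = q\<^sup>n\<close> the series terminates and
  the integral is a finite sum of residues, and the two agree by Watson's transformation
  of a terminating very-well-poised \<open>8\<phi>7\<close> into a balanced \<open>4\<phi>3\<close> (\<open>watson_finite\<close>). As these points accumulate
  at \<open>0\<close>, the identity theorem gives equality in the disc (\<open>watson_integral_identity\<close>).

\<^item> Watson's transformation is two applications of Bailey's lemma to the unit Bailey pair; Bailey's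
  lemma in turn is the \<open>q\<close>-Saalschuetz sum, which telescopes.

For \<open>h = qa/(de)\<close> the product \<open>\<theta>(h) \<theta>(hc) = \<theta>(qa/(de)) \<theta>(f)\<close> may vanish, and then the first
ingredient says nothing about other values of \<open>h\<close>. Since both sides are continuous in \<open>f\<close>, a perturbation of \<open>f\<close> removes the zero of
\<open>\<theta>(f)\<close>, and after exchanging the roles of \<open>e\<close> and \<open>f\<close> a second perturbation removes
the other one (\<open>sides_eq\<close>).\<close>

section \<open>Shifted factorials and theta functions\<close>

locale q_base =
  fixes q :: complex
  assumes q_nz: "q \<noteq> 0" and q_lt: "norm q < 1"
begin

abbreviation poch :: "complex \<Rightarrow> nat \<Rightarrow> complex" where
  "poch x n \<equiv> qpoch x q n"

abbreviation pinf :: "complex \<Rightarrow> complex" where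
  "pinf x \<equiv> qpoch_inf x q"

abbreviation theta :: "complex \<Rightarrow> complex" where
  "theta x \<equiv> qtheta x q"

lemma poch_0 [simp]: "poch x 0 = 1"
  by (simp add: qpoch_def)

lemma poch_Suc: "poch x (Suc n) = poch x n * (1 - x * q ^ n)"
  by (simp add: qpoch_def)

lemma poch_add: "poch x (m + n) = poch x m * poch (x * q ^ m) n"
  by (induction n) (simp_all add: poch_Suc power_add mult_ac)

lemma poch_Suc_left: "poch x (Suc n) = (1 - x) * poch (x * q) n"
  using poch_add[of x 1 n] by (simp add: poch_Suc)

lemma poch_eq_0_iff: "poch x n = 0 \<longleftrightarrow> (\<exists>j<n. x * q ^ j = 1)"
  by (auto simp: qpoch_def)

lemma q_power_neq_1: "n > 0 \<Longrightarrow> q ^ n \<noteq> 1"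
  using q_lt by (metis norm_one norm_power not_gr_zero norm_ge_zero power_eq_1_iff less_irrefl)

lemma poch_q_nz: "poch q n \<noteq> 0"
  using q_power_neq_1 by (metis poch_eq_0_iff power_Suc zero_less_Suc)

lemma q_powers_tendsto_0: "(\<lambda>n. q ^ n) \<longlonglongrightarrow> 0"
  using q_lt by (rule LIMSEQ_power_zero)

lemma pinf_convergent: "convergent_prod (\<lambda>j. 1 - x * q ^ j)"
proof (rule abs_convergent_prod_imp_convergent_prod)
  have "summable (\<lambda>j. norm x * norm q ^ j)"
    using q_lt by (intro summable_mult summable_geometric) auto
  then show "abs_convergent_prod (\<lambda>j. 1 - x * q ^ j)"
    by (simp add: abs_convergent_prod_conv_summable norm_mult norm_power)
qed

lemma poch_tendsto_pinf: "(\<lambda>n. poch x n) \<longlonglongrightarrow> pinf x"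
  using convergent_prod_LIMSEQ[OF pinf_convergent[of x]]
  unfolding qpoch_def qpoch_inf_def by (subst LIMSEQ_lessThan_iff_atMost)

lemma pinf_split: "pinf x = poch x n * pinf (x * q ^ n)"
proof -
  have "(\<lambda>m. poch x (m + n)) \<longlonglongrightarrow> pinf x"
    using poch_tendsto_pinf by (rule LIMSEQ_ignore_initial_segment)
  moreover have "(\<lambda>m. poch x (m + n)) \<longlonglongrightarrow> poch x n * pinf (x * q ^ n)"
    unfolding add.commute[of _ n] poch_add by (intro tendsto_intros poch_tendsto_pinf)
  ultimately show ?thesis
    by (rule LIMSEQ_unique)
qed

lemma pinf_eq_0_iff: "pinf x = 0 \<longleftrightarrow> (\<exists>j. x * q ^ j = 1)"
  unfolding qpoch_inf_def
  using has_prod_eq_0_iff[OF convergent_prod_has_prod[OF pinf_convergent[of x]]]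
  by (auto simp: image_iff)

lemma pinf_nz: "norm x < 1 \<Longrightarrow> pinf x \<noteq> 0"
proof
  assume x: "norm x < 1" and "pinf x = 0"
  then obtain j where j: "x * q ^ j = 1" by (auto simp: pinf_eq_0_iff)
  have "norm (x * q ^ j) \<le> norm x * 1"
    unfolding norm_mult norm_power using q_lt by (intro mult_left_mono power_le_one) auto
  with x j show False by simp
qed

lemma poch_uniform_limit: "uniform_limit (cball 0 R) (\<lambda>n x. poch x n) pinf sequentially"
proof -
  have "uniformly_convergent_on (cball 0 R) (\<lambda>n x. \<Prod>j<n. 1 - x * q ^ j)"
  proof (rule uniformly_convergent_on_prod')
    show "uniformly_convergent_on (cball 0 R)
        (\<lambda>N x. \<Sum>n<N. norm ((1 - x * q ^ n) - 1))"
    proof (rule Weierstrass_m_test')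
      show "norm (norm ((1 - x * q ^ n) - 1)) \<le> R * norm q ^ n" if "x \<in> cball 0 R" for n x
        using that by (simp add: norm_mult norm_power mult_right_mono)
      show "summable (\<lambda>n. R * norm q ^ n)"
        using q_lt by (intro summable_mult summable_geometric) auto
    qed
  qed (auto intro!: continuous_intros)
  then obtain l where l: "uniform_limit (cball 0 R) (\<lambda>n x. poch x n) l sequentially"
    unfolding qpoch_def uniformly_convergent_on_def by blast
  moreover have "l x = pinf x" if "x \<in> cball 0 R" for x
    using tendsto_uniform_limitI[OF l that] poch_tendsto_pinf by (rule LIMSEQ_unique)
  ultimately show ?thesis
    by (metis (mono_tags, lifting) uniform_limit_cong')
qed

lemma pinf_holomorphic_UNIV: "pinf holomorphic_on UNIV"
proof (rule holomorphic_uniform_sequence)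
  show "\<exists>d>0. cball x d \<subseteq> UNIV \<and> uniform_limit (cball x d) (\<lambda>n x. poch x n) pinf sequentially"
    for x :: complex
  proof (intro exI[of _ 1] conjI)
    show "uniform_limit (cball x 1) (\<lambda>n x. poch x n) pinf sequentially"
      using poch_uniform_limit[of "norm x + 1"]
      by (rule uniform_limit_on_subset)
         (auto simp: cball_subset_cball_iff)
  qed auto
qed (auto simp: qpoch_def intro!: holomorphic_intros)

lemma pinf_holomorphic [holomorphic_intros]:
  "g holomorphic_on S \<Longrightarrow> (\<lambda>x. pinf (g x)) holomorphic_on S"
  using holomorphic_on_compose_gen[OF _ pinf_holomorphic_UNIV, of g S] by (simp add: o_def)

lemma pinf_continuous [continuous_intros]:
  "continuous_on S g \<Longrightarrow> continuous_on S (\<lambda>x. pinf (g x))"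
  using continuous_on_compose2[OF holomorphic_on_imp_continuous_on[OF pinf_holomorphic_UNIV], of S g]
  by simp

lemma theta_eq: "theta x = pinf x * pinf (q / x)"
  by (simp add: qtheta_def qpochs_inf_def)

text \<open>Passing from \<open>x\<close> to \<open>qx\<close> removes the factor \<open>1 - x\<close> from \<open>(x)\<^sub>\<infinity>\<close> and adds the factor \<open>1 - 1/x\<close> to
\<open>(q/x)\<^sub>\<infinity>\<close>; the quotient of the two factors is \<open>- 1/x\<close>.\<close>

lemma theta_shift:
  assumes "x \<noteq> 0"
  shows "theta (q * x) = - theta x / x"
proof -
  have "pinf x = (1 - x) * pinf (x * q)" "pinf (1 / x) = (1 - 1 / x) * pinf (q / x)"
    using pinf_split[of x 1] pinf_split[of "1 / x" 1] by (simp_all add: poch_Suc)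
  then have "theta (q * x) = pinf (q * x) * ((1 - 1 / x) * pinf (q / x))"
    "theta x = (1 - x) * pinf (q * x) * pinf (q / x)"
    using q_nz by (simp_all add: theta_eq mult.commute)
  moreover have "u * ((1 - 1 / x) * v) = - ((1 - x) * u * v) / x" for u v
    using assms by (simp add: field_simps)
  ultimately show ?thesis
    by metis
qed

lemma theta_inverse:
  assumes "x \<noteq> 0"
  shows "theta (1 / x) = - theta x / x"
  using theta_shift[OF assms] assms q_nz by (simp add: theta_eq mult.commute)

lemma theta_holomorphic [holomorphic_intros]:
  "g holomorphic_on S \<Longrightarrow> (\<And>x. x \<in> S \<Longrightarrow> g x \<noteq> 0) \<Longrightarrow> (\<lambda>x. theta (g x)) holomorphic_on S"
  unfolding theta_eq by (intro holomorphic_intros) auto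

lemma theta_continuous [continuous_intros]:
  "continuous_on S g \<Longrightarrow> (\<And>x. x \<in> S \<Longrightarrow> g x \<noteq> 0) \<Longrightarrow> continuous_on S (\<lambda>x. theta (g x))"
  unfolding theta_eq by (intro continuous_intros) auto

lemma theta_1 [simp]: "theta 1 = 0"
  by (simp add: theta_eq pinf_eq_0_iff) (metis mult_1 power_0)

lemma theta_eq_0_iff:
  assumes "x \<noteq> 0"
  shows "theta x = 0 \<longleftrightarrow> (\<exists>k::int. x = q powi k)"
proof
  assume "theta x = 0"
  then consider j where "x * q ^ j = 1" | j where "q / x * q ^ j = 1"
    by (auto simp: theta_eq pinf_eq_0_iff)
  then show "\<exists>k::int. x = q powi k"
  proof cases
    case 1
    then have "x = q powi (- int j)"
      using q_nz by (simp add: power_int_minus field_simps)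
    then show ?thesis by blast
  next
    case 2
    then have "x = q powi (int (Suc j))"
      using assms q_nz by (simp add: field_simps power_int_of_nat del: of_nat_Suc)
    then show ?thesis by blast
  qed
next
  assume "\<exists>k::int. x = q powi k"
  then obtain k :: int where k: "x = q powi k" by blast
  show "theta x = 0"
  proof (cases "k \<le> 0")
    case True
    then have "x * q ^ nat (- k) = 1"
      using k q_nz by (simp add: power_int_def power_int_minus field_simps)
    then show ?thesis by (auto simp: theta_eq pinf_eq_0_iff)
  next
    case False
    then have "q / x * q ^ nat (k - 1) = 1"
      using k q_nz by (simp add: power_int_def nat_diff_distrib flip: power_Suc)
    then show ?thesis unfolding theta_eq pinf_eq_0_iff mult_eq_0_iff by blast
  qed
qed

end

section \<open>Bailey's lemma and Watson's terminating transformation\<close>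

context q_base
begin

text \<open>The creative-telescoping certificate of the \<open>q\<close>-Saalschuetz sum: up to the factor that the closed form
acquires from \<open>N\<close> to \<open>N + 1\<close>, the summand changes by the difference of \<open>U\<close> at consecutive
indices. The parameter \<open>C\<close> is determined by the balancing condition \<open>C = QDE\<close>.\<close>

lemma q_saalschuetz_step:
  fixes D E Q :: complex
  defines "C \<equiv> Q * D * E"
  defines "t \<equiv> \<lambda>N i. poch D i * poch E i * poch Q (N - i) * Q ^ i * poch (C * q ^ i) (N - i)
                      / (poch q i * poch q (N - i))"
  defines "U \<equiv> \<lambda>N i. q ^ (N - i) * Q * (1 - D * q ^ i) * (1 - E * q ^ i) * t N i"
  assumes "i \<le> Suc N"
  shows "(1 - q ^ Suc N) * t (Suc N) i =
     (if i \<le> N then (1 - Q * E * q ^ N) * (1 - Q * D * q ^ N) * t N i - U N i else 0)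
     + (if i = 0 then 0 else U N (i - 1))"
proof -
  consider "i = 0" | "i = Suc N" | j m where "i = Suc j" "N = Suc (j + m)"
  proof (cases i)
    case (Suc j)
    moreover have "\<exists>m. N = Suc (j + m)" if "Suc j \<noteq> Suc N"
      using assms(4) Suc that less_iff_Suc_add[of j N] by auto
    ultimately show ?thesis using that by auto
  qed (use that in auto)
  then show ?thesis
  proof cases
    case 1
    have poly: "(1 - Q * q ^ N) * (1 - C * q ^ N)
        = (1 - Q * E * q ^ N) * (1 - Q * D * q ^ N) - q ^ N * Q * (1 - D) * (1 - E)"
      by (simp add: C_def algebra_simps)
    have "(1 - q ^ Suc N) * t (Suc N) 0 = ((1 - Q * q ^ N) * (1 - C * q ^ N)) * t N 0"
      using q_power_neq_1[of "Suc N"] poch_q_nz[of N] by (simp add: t_def poch_Suc)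
    also have "\<dots> = (1 - Q * E * q ^ N) * (1 - Q * D * q ^ N) * t N 0 - U N 0"
      unfolding poly left_diff_distrib[of _ _ "t N 0"] by (simp add: U_def)
    finally show ?thesis
      by (simp add: 1)
  next
    case 2
    show ?thesis
      using q_power_neq_1[of "Suc N"] poch_q_nz[of N]
      by (simp add: 2 t_def U_def poch_Suc mult_ac)
  next
    case 3
    define X Y where "X = q ^ j" and "Y = q ^ m"
    define A where "A = poch D j * poch E j * poch Q m * Q ^ j * poch (C * q * X) m / (poch q j * poch q m)"
    have nz: "1 - q * X \<noteq> 0" "1 - q * Y \<noteq> 0" "poch q j \<noteq> 0" "poch q m \<noteq> 0"
      using q_power_neq_1[of "Suc j"] q_power_neq_1[of "Suc m"] poch_q_nz by (auto simp: X_def Y_def)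
    have "t (Suc N) i = A * (1 - D * X) * (1 - E * X) * (1 - Q * Y) * Q * (1 - C * q * X * Y)
            / ((1 - q * X) * (1 - q * Y))"
      using nz by (simp add: 3 t_def A_def poch_Suc X_def Y_def mult_ac)
    moreover have "t N i = A * (1 - D * X) * (1 - E * X) * Q / (1 - q * X)"
      using nz by (simp add: 3 t_def A_def poch_Suc X_def Y_def mult_ac)
    moreover have "t N j = A * (1 - Q * Y) * (1 - C * X) / (1 - q * Y)"
      using nz poch_Suc_left[of "C * X" m]
      by (simp add: 3 t_def A_def poch_Suc X_def Y_def mult_ac)
    moreover have "q ^ N = q * X * Y" "q ^ i = q * X" "q ^ (N - i) = Y" "q ^ (N - j) = q * Y"
      by (simp_all add: 3 X_def Y_def power_add)
    ultimately have t: "t (Suc N) i = A * (1 - D * X) * (1 - E * X) * (1 - Q * Y) * Q * (1 - C * q * X * Y)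
            / ((1 - q * X) * (1 - q * Y))"
        "t N i = A * (1 - D * X) * (1 - E * X) * Q / (1 - q * X)"
        "t N j = A * (1 - Q * Y) * (1 - C * X) / (1 - q * Y)"
      and pow: "q ^ Suc N = q\<^sup>2 * X * Y" "q ^ N = q * X * Y" "q ^ i = q * X" "q ^ (N - i) = Y" "q ^ (N - j) = q * Y" "q ^ j = X"
      by (simp_all add: X_def power2_eq_square)
    have t1: "(1 - q ^ Suc N) * t (Suc N) i
        = A * (1 - D * X) * (1 - E * X) * Q * (1 - Q * Y) * ((1 - q\<^sup>2 * X * Y) * (1 - C * q * X * Y))
            / ((1 - q * X) * (1 - q * Y))"
      unfolding t pow by simp
    have t2: "(1 - Q * E * q ^ N) * (1 - Q * D * q ^ N) * t N i - U N i
        = A * (1 - D * X) * (1 - E * X) * Q / (1 - q * X)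
          * ((1 - Q * E * (q * X * Y)) * (1 - Q * D * (q * X * Y))
             - Y * Q * (1 - D * (q * X)) * (1 - E * (q * X)))"
      unfolding t pow U_def by (simp only: right_diff_distrib[of "_ / _"] mult_ac)
    have t3: "U N j = A * (1 - D * X) * (1 - E * X) * Q * (1 - Q * Y) * (q * Y * (1 - C * X)) / (1 - q * Y)"
      unfolding t pow U_def by simp
    \<comment> \<open>The two polynomial identities that make the certificate work, in \<open>X = q\<^sup>j\<close> and \<open>Y = q\<^sup>m\<close>.\<close>
    have poly1: "(1 - Q * E * (q * X * Y)) * (1 - Q * D * (q * X * Y))
             - Y * Q * (1 - D * (q * X)) * (1 - E * (q * X))
        = (1 - Q * Y) * (1 - C * q\<^sup>2 * X\<^sup>2 * Y)"
      by (simp add: C_def algebra_simps power2_eq_square)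
    have poly2: "(1 - q\<^sup>2 * X * Y) * (1 - C * q * X * Y)
        = (1 - C * q\<^sup>2 * X\<^sup>2 * Y) * (1 - q * Y) + q * Y * (1 - C * X) * (1 - q * X)"
      by (simp add: algebra_simps power2_eq_square)
    have fraction: "K * (u * r + v * p) / (p * r) = K0 / p * (z * u) + K * v / r"
      if "K = K0 * z" "p \<noteq> 0" "r \<noteq> 0" for K K0 z u v p r :: complex
      using that by (simp add: field_simps)
    have "(1 - q ^ Suc N) * t (Suc N) i =
        ((1 - Q * E * q ^ N) * (1 - Q * D * q ^ N) * t N i - U N i) + U N j"
      unfolding t1 t2 t3 poly1 poly2 using nz by (intro fraction) auto
    then show ?thesis
      using 3 by simp
  qed
qed

text \<open>The summation of a balanced terminating \<open>3\<phi>2\<close>, with the denominators that involve \<open>C = QDE\<close> and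
\<open>Q\<close> cleared. In this form it is a polynomial identity in \<open>D\<close>, \<open>E\<close> and \<open>Q\<close> and holds without
exceptional parameter values.\<close>

lemma q_saalschuetz:
  "(\<Sum>i\<le>N. poch D i * poch E i * poch Q (N - i) * Q ^ i * poch (Q * D * E * q ^ i) (N - i)
       / (poch q i * poch q (N - i)))
   = poch (Q * E) N * poch (Q * D) N / poch q N"
proof (induction N)
  case 0
  then show ?case by simp
next
  case (Suc N)
  define t where "t = (\<lambda>N i. poch D i * poch E i * poch Q (N - i) * Q ^ i *
      poch (Q * D * E * q ^ i) (N - i) / (poch q i * poch q (N - i)))"
  define U where "U = (\<lambda>i. q ^ (N - i) * Q * (1 - D * q ^ i) * (1 - E * q ^ i) * t N i)"
  define l where "l = (1 - Q * E * q ^ N) * (1 - Q * D * q ^ N)"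
  have "(1 - q ^ Suc N) * (\<Sum>i\<le>Suc N. t (Suc N) i)
      = (\<Sum>i\<le>Suc N. (if i \<le> N then l * t N i - U i else 0) + (if i = 0 then 0 else U (i - 1)))"
    unfolding sum_distrib_left l_def U_def t_def
    by (intro sum.cong refl q_saalschuetz_step) auto
  also have "\<dots> = (\<Sum>i\<le>N. l * t N i - U i) + (\<Sum>i\<le>N. U i)"
    unfolding sum.distrib
    by (subst (2) sum.atMost_Suc_shift) simp
  also have "\<dots> = l * (\<Sum>i\<le>N. t N i)"
    by (simp add: sum_subtractf sum_distrib_left)
  also have "(\<Sum>i\<le>N. t N i) = poch (Q * E) N * poch (Q * D) N / poch q N"
    using Suc.IH by (simp add: t_def)
  finally have "(\<Sum>i\<le>Suc N. t (Suc N) i) = poch (Q * E) (Suc N) * poch (Q * D) (Suc N) / poch q (Suc N)"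
    using q_power_neq_1[of "Suc N"] poch_q_nz[of N] by (simp add: l_def poch_Suc field_simps)
  then show ?case
    by (simp only: t_def)
qed

text \<open>The very-well-poised part \<open>(a, q\<surd>a, - q\<surd>a)\<^sub>r / (q, \<surd>a, - \<surd>a)\<^sub>r\<close> of the series, in which the two square
roots combine to \<open>(1 - aq\<^sup>2\<^sup>r)/(1 - a)\<close>.\<close>

definition vwp :: "complex \<Rightarrow> nat \<Rightarrow> complex" where
  "vwp a r = (1 - a * q ^ (2 * r)) * poch a r / ((1 - a) * poch q r)"

text \<open>A Bailey pair relative to \<open>a\<close> is a pair of sequences with
\<open>\<beta>\<^sub>n = (\<Sum>r\<le>n. \<alpha>\<^sub>r / ((q)\<^sub>n\<^sub>-\<^sub>r (aq)\<^sub>n\<^sub>+\<^sub>r))\<close>. Here \<open>\<beta>\<^sub>n\<close> is multiplied by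
\<open>(aq)\<^sub>\<infinity>\<close>, so that values \<open>a = q\<^sup>-\<^sup>m\<close>, for which \<open>(aq)\<^sub>n\<^sub>+\<^sub>r\<close> vanishes, are included.\<close>

definition bailey_transform :: "complex \<Rightarrow> (nat \<Rightarrow> complex) \<Rightarrow> nat \<Rightarrow> complex" where
  "bailey_transform a \<alpha> n = (\<Sum>r\<le>n. \<alpha> r * pinf (a * q ^ (n + r + 1)) / poch q (n - r))"

text \<open>Bailey's lemma: the factor by which \<open>\<alpha>\<^sub>r\<close> is multiplied, together with the kernel
\<open>1/((q)\<^sub>n\<^sub>-\<^sub>r (aq)\<^sub>n\<^sub>+\<^sub>r)\<close>, is a \<open>q\<close>-Saalschuetz sum with parameters \<open>bq\<^sup>r\<close>, \<open>cq\<^sup>r\<close> and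
\<open>aq/(bc)\<close>. Inserting that sum and exchanging the order of summation leaves the old Bailey transform inside.\<close>

lemma bailey_lemma:
  assumes b: "b \<noteq> 0" "poch (a * q / b) n \<noteq> 0" and c: "c \<noteq> 0" "poch (a * q / c) n \<noteq> 0"
  shows "bailey_transform a
           (\<lambda>r. poch b r * poch c r / (poch (a * q / b) r * poch (a * q / c) r) * (a * q / (b * c)) ^ r * \<alpha> r) n
       = (\<Sum>j\<le>n. poch b j * poch c j * poch (a * q / (b * c)) (n - j) * (a * q / (b * c)) ^ j
                    / poch q (n - j) * bailey_transform a \<alpha> j)
         / (poch (a * q / b) n * poch (a * q / c) n)"
proof -
  define Q where "Q = a * q / (b * c)"
  have Q: "a * q / b = Q * c" "a * q / c = Q * b" "Q * b * c = a * q"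
    using b c by (auto simp: Q_def)
  have key: "poch b r * poch c r / (poch (Q * c) r * poch (Q * b) r) * Q ^ r
               * pinf (a * q ^ (n + r + 1)) / poch q (n - r)
      = (\<Sum>j\<in>{r..n}. poch b j * poch c j * poch Q (n - j) * Q ^ j / poch q (n - j)
            * (pinf (a * q ^ (j + r + 1)) / poch q (j - r))) / (poch (Q * c) n * poch (Q * b) n)"
    if r: "r \<le> n" for r
  proof -
    obtain N where N: "n = r + N" using r le_Suc_ex by blast
    have nz: "poch (Q * c) r \<noteq> 0" "poch (Q * b) r \<noteq> 0" "poch (Q * c * q ^ r) N \<noteq> 0" "poch (Q * b * q ^ r) N \<noteq> 0"
      using b(2) c(2) unfolding Q N poch_add by auto
    have "(\<Sum>j\<in>{r..n}. poch b j * poch c j * poch Q (n - j) * Q ^ j / poch q (n - j)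
            * (pinf (a * q ^ (j + r + 1)) / poch q (j - r)))
        = (\<Sum>i\<le>N. poch b (r + i) * poch c (r + i) * poch Q (N - i) * Q ^ (r + i) / poch q (N - i)
            * (pinf (a * q ^ (r + i + r + 1)) / poch q i))"
      unfolding N
      by (rule sum.reindex_bij_witness[of _ "\<lambda>i. r + i" "\<lambda>j. j - r"]) (auto simp: add.commute[of N r])
    also have "\<dots> = (\<Sum>i\<le>N. poch (b * q ^ r) i * poch (c * q ^ r) i * poch Q (N - i) * Q ^ i
            * poch (Q * (b * q ^ r) * (c * q ^ r) * q ^ i) (N - i) / (poch q i * poch q (N - i)))
            * (poch b r * poch c r * Q ^ r * pinf (a * q ^ (n + r + 1)))"
      unfolding sum_distrib_right
    proof (intro sum.cong refl, goal_cases)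
      case (1 i)
      then obtain m where m: "N = i + m" using le_Suc_ex by auto
      define Y Z where "Y = a * q ^ (r + i + r + 1)" and "Z = a * q ^ (n + r + 1)"
      have "Q * (b * q ^ r) * (c * q ^ r) * q ^ i = Y"
        using arg_cong[OF Q(3), of "\<lambda>x. x * q ^ (r + r + i)"]
        by (simp only: Y_def) (simp add: power_add mult_ac)
      moreover have "pinf Y = poch Y m * pinf Z"
        unfolding Y_def Z_def by (subst pinf_split[of _ m]) (simp add: m N power_add mult_ac)
      ultimately show ?case
        unfolding Y_def[symmetric] Z_def[symmetric] by (simp add: m poch_add power_add mult_ac)
    qed
    also have "\<dots> = poch (Q * c * q ^ r) N * poch (Q * b * q ^ r) N / poch q N
            * (poch b r * poch c r * Q ^ r * pinf (a * q ^ (n + r + 1)))"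
      by (subst q_saalschuetz) (simp add: mult_ac)
    finally show ?thesis
      using nz by (simp add: N poch_add mult_ac)
  qed
  have "bailey_transform a
           (\<lambda>r. poch b r * poch c r / (poch (Q * c) r * poch (Q * b) r) * Q ^ r * \<alpha> r) n
      = (\<Sum>r\<le>n. \<alpha> r * (poch b r * poch c r / (poch (Q * c) r * poch (Q * b) r) * Q ^ r
               * pinf (a * q ^ (n + r + 1)) / poch q (n - r)))"
    unfolding bailey_transform_def by (intro sum.cong) (auto simp: mult_ac)
  also have "\<dots> = (\<Sum>r\<le>n. \<Sum>j\<in>{r..n}. poch b j * poch c j * poch Q (n - j) * Q ^ j / poch q (n - j)
            * (\<alpha> r * pinf (a * q ^ (j + r + 1)) / poch q (j - r))) / (poch (Q * c) n * poch (Q * b) n)"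
    unfolding sum_divide_distrib[of _ "{..n}"]
    by (intro sum.cong refl, subst key) (auto simp: sum_distrib_left mult_ac)
  also have "(\<Sum>r\<le>n. \<Sum>j\<in>{r..n}. poch b j * poch c j * poch Q (n - j) * Q ^ j / poch q (n - j)
            * (\<alpha> r * pinf (a * q ^ (j + r + 1)) / poch q (j - r)))
      = (\<Sum>j\<le>n. \<Sum>r\<le>j. poch b j * poch c j * poch Q (n - j) * Q ^ j / poch q (n - j)
            * (\<alpha> r * pinf (a * q ^ (j + r + 1)) / poch q (j - r)))"
    by (subst sum.Sigma, simp, simp, subst sum.Sigma, simp, simp,
        rule sum.reindex_bij_witness[of _ prod.swap prod.swap]) auto
  also have "\<dots> = (\<Sum>j\<le>n. poch b j * poch c j * poch Q (n - j) * Q ^ j / poch q (n - j)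
                        * bailey_transform a \<alpha> j)"
    by (simp add: bailey_transform_def sum_distrib_left)
  finally show ?thesis
    unfolding Q by (simp add: Q_def)
qed

text \<open>The unit Bailey pair. For \<open>n > 0\<close> all partial sums have a closed form, and the last one contains the
factor \<open>1 - q\<^sup>0 = 0\<close>.\<close>

lemma bailey_unit:
  assumes a: "a \<noteq> 1"
  shows "bailey_transform a (\<lambda>r. vwp a r * (\<Prod>j<r. - (q ^ j))) n = (if n = 0 then pinf (a * q) else 0)"
proof (cases n)
  case 0
  then show ?thesis using a by (simp add: bailey_transform_def vwp_def)
next
  case (Suc n')
  define u where "u = (\<lambda>r. vwp a r * (\<Prod>j<r. - (q ^ j)) * pinf (a * q ^ (n + r + 1)) / poch q (n - r))"
  have nz: "1 - a \<noteq> 0" "1 - q ^ n \<noteq> 0"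
    using a q_power_neq_1[of n] Suc by auto
  have partial: "(\<Sum>r\<le>m. u r) = (\<Prod>j<m. - (q ^ j)) * q ^ m * (1 - q ^ (n - m)) * poch a (Suc m)
       * pinf (a * q ^ (n + m + 1)) / ((1 - a) * poch q m * poch q (n - m) * (1 - q ^ n))"
    if "m \<le> n" for m
    using that
  proof (induction m)
    case 0
    then show ?case
      using nz by (simp add: u_def vwp_def poch_Suc)
  next
    case (Suc m)
    then obtain k where k: "n = Suc (m + k)" using less_imp_Suc_add by fastforce
    define X Y where "X = q ^ m" and "Y = q ^ k"
    define K where "K = (\<Prod>j<m. - (q ^ j)) * poch a (Suc m) * pinf (a * q ^ (n + m + 2))
                     / ((1 - a) * poch q m * poch q k)"
    have nz': "1 - q * X \<noteq> 0" "1 - q * Y \<noteq> 0" "poch q m \<noteq> 0" "poch q k \<noteq> 0"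
      using q_power_neq_1[of "Suc m"] q_power_neq_1[of "Suc k"] poch_q_nz by (auto simp: X_def Y_def)
    have pn: "q ^ n = q * X * Y" by (simp add: k X_def Y_def power_add)
    have sp: "pinf (a * q ^ (n + m + 1)) = (1 - a * (q * X * Y) * X * q) * pinf (a * q ^ (n + m + 2))"
      by (subst pinf_split[of _ 1]) (simp add: poch_Suc power_add k X_def Y_def mult_ac)
    have "(\<Sum>r\<le>m. u r) = (\<Prod>j<m. - (q ^ j)) * X * (1 - q * Y) * poch a (Suc m)
       * ((1 - a * (q * X * Y) * X * q) * pinf (a * q ^ (n + m + 2)))
       / ((1 - a) * poch q m * (poch q k * (1 - q * Y)) * (1 - q * X * Y))"
      using Suc.IH Suc.prems sp by (simp add: pn k poch_Suc[of q] X_def Y_def power_add mult_ac)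
    also have "\<dots> = K * X * (1 - a * (q * X * Y) * X * q) / (1 - q * X * Y)"
      using nz' by (simp add: K_def mult_ac)
    finally have 1: "(\<Sum>r\<le>m. u r) = K * X * (1 - a * (q * X * Y) * X * q) / (1 - q * X * Y)" .
    have 2: "u (Suc m) = - K * X * (1 - a * (q * X) ^ 2) / (1 - q * X)"
      using nz' by (simp add: u_def K_def vwp_def k poch_Suc[of q] X_def power_mult_distrib
          flip: power_mult) (simp add: power2_eq_square mult_ac)
    have "(\<Sum>r\<le>Suc m. u r) = - K * X * q * X * (1 - Y) * (1 - a * q * X) / ((1 - q * X) * (1 - q * X * Y))"
      using nz' nz(2) unfolding sum.atMost_Suc 1 2 pn
      by (simp add: divide_simps) (simp add: algebra_simps power2_eq_square)
    also have "\<dots> = (\<Prod>j<Suc m. - (q ^ j)) * q ^ Suc m * (1 - q ^ (n - Suc m)) * poch a (Suc (Suc m))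
       * pinf (a * q ^ (n + Suc m + 1)) / ((1 - a) * poch q (Suc m) * poch q (n - Suc m) * (1 - q ^ n))"
      using nz' nz unfolding pn
      by (simp add: K_def poch_Suc[of a "Suc m"] poch_Suc[of q] k X_def Y_def mult_ac)
    finally show ?case .
  qed
  show ?thesis
    using partial[of n] Suc by (simp add: bailey_transform_def u_def)
qed

text \<open>Watson's transformation for the value \<open>f = q\<^sup>-\<^sup>n\<close> of the fifth parameter: two Bailey steps, with
\<open>(b, c)\<close> and then with \<open>(d, e)\<close>, starting from the unit pair, whose transform is concentrated at \<open>0\<close>. The product over \<open>q\<^sup>n - q\<^sup>j\<close> is
\<open>(q\<^sup>-\<^sup>n)\<^sub>r q\<^sup>n\<^sup>r\<close>, and it supplies both the signs of the unit pair and the factor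
\<open>(q)\<^sub>n/(q)\<^sub>n\<^sub>-\<^sub>r\<close>.\<close>

lemma watson_finite:
  assumes a: "a \<noteq> 1" and nz: "b \<noteq> 0" "c \<noteq> 0" "d \<noteq> 0" "e \<noteq> 0"
    and den: "\<And>n. poch (a * q / b) n \<noteq> 0" "\<And>n. poch (a * q / c) n \<noteq> 0"
      "\<And>n. poch (a * q / d) n \<noteq> 0" "\<And>n. poch (a * q / e) n \<noteq> 0"
  shows "(\<Sum>r\<le>n. vwp a r * (poch b r * poch c r * poch d r * poch e r)
            / (poch (a * q / b) r * poch (a * q / c) r * poch (a * q / d) r * poch (a * q / e) r)
            * (a\<^sup>2 * q\<^sup>2 / (b * c * d * e)) ^ r * (\<Prod>j<r. q ^ n - q ^ j) * pinf (a * q ^ (n + r + 1)))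
       = poch q n * pinf (a * q) / (poch (a * q / d) n * poch (a * q / e) n)
         * (\<Sum>j\<le>n. poch d j * poch e j * poch (a * q / (b * c)) j * poch (a * q / (d * e)) (n - j)
             * (a * q / (d * e)) ^ j
             / (poch q (n - j) * poch q j * poch (a * q / b) j * poch (a * q / c) j))"
proof -
  define \<alpha>1 where "\<alpha>1 = (\<lambda>r. poch b r * poch c r / (poch (a * q / b) r * poch (a * q / c) r)
      * (a * q / (b * c)) ^ r * (vwp a r * (\<Prod>j<r. - (q ^ j))))"
  define \<alpha>2 where "\<alpha>2 = (\<lambda>r. poch d r * poch e r / (poch (a * q / d) r * poch (a * q / e) r)
      * (a * q / (d * e)) ^ r * \<alpha>1 r)"
  have \<beta>1: "bailey_transform a \<alpha>1 j =
      pinf (a * q) * poch (a * q / (b * c)) j / (poch q j * poch (a * q / b) j * poch (a * q / c) j)" for j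
  proof -
    have "bailey_transform a \<alpha>1 j = (\<Sum>i\<le>j. poch b i * poch c i * poch (a * q / (b * c)) (j - i)
        * (a * q / (b * c)) ^ i / poch q (j - i) * (if i = 0 then pinf (a * q) else 0))
         / (poch (a * q / b) j * poch (a * q / c) j)"
      unfolding \<alpha>1_def using nz den by (subst bailey_lemma) (auto simp: bailey_unit[OF a])
    also have "\<dots> = (\<Sum>i\<in>{0}. poch b i * poch c i * poch (a * q / (b * c)) (j - i)
        * (a * q / (b * c)) ^ i / poch q (j - i) * (if i = 0 then pinf (a * q) else 0))
         / (poch (a * q / b) j * poch (a * q / c) j)"
      by (intro arg_cong2[of _ _ _ _ "(/)"] refl sum.mono_neutral_right) auto
    finally show ?thesis by (simp add: mult_ac)
  qed
  have "(\<Prod>j<r. q ^ n - q ^ j) = (\<Prod>j<r. - (q ^ j)) * (poch q n / poch q (n - r))" if "r \<le> n" for r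
    using that
  proof (induction r)
    case 0
    then show ?case using poch_q_nz by simp
  next
    case (Suc r)
    then obtain k where k: "n = Suc (r + k)" using less_imp_Suc_add by fastforce
    have "q ^ n - q ^ r = - (q ^ r) * (1 - q * q ^ k)"
      by (simp add: k power_add algebra_simps)
    then show ?case
      using Suc q_power_neq_1[of "Suc k"] by (simp add: k poch_Suc[of q])
  qed
  then have "(\<Sum>r\<le>n. vwp a r * (poch b r * poch c r * poch d r * poch e r)
            / (poch (a * q / b) r * poch (a * q / c) r * poch (a * q / d) r * poch (a * q / e) r)
            * (a\<^sup>2 * q\<^sup>2 / (b * c * d * e)) ^ r * (\<Prod>j<r. q ^ n - q ^ j) * pinf (a * q ^ (n + r + 1)))
     = poch q n * bailey_transform a \<alpha>2 n"
    unfolding bailey_transform_def sum_distrib_left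
    by (intro sum.cong) (auto simp: \<alpha>2_def \<alpha>1_def power2_eq_square power_mult_distrib power_divide mult_ac)
  also have "bailey_transform a \<alpha>2 n =
     (\<Sum>j\<le>n. poch d j * poch e j * poch (a * q / (d * e)) (n - j) * (a * q / (d * e)) ^ j
                    / poch q (n - j) * bailey_transform a \<alpha>1 j)
         / (poch (a * q / d) n * poch (a * q / e) n)"
    unfolding \<alpha>2_def using nz den by (intro bailey_lemma) auto
  finally show ?thesis
    unfolding \<beta>1 by (simp add: sum_distrib_left sum_divide_distrib mult_ac)
qed

end

section \<open>Partial fractions and integrals over a circle\<close>

context q_base
begin

text \<open>Reversing the order of the factors of \<open>(\<alpha>/q\<^sup>m)\<^sub>m\<close> gives \<open>(q/\<alpha>)\<^sub>m\<close> up to a monomial; comparison with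
\<open>\<alpha> = 1\<close> eliminates the powers of \<open>q\<close>.\<close>

lemma poch_reflect_ratio:
  assumes "\<alpha> \<noteq> 0"
  shows "poch (\<alpha> / q ^ m) m * poch q m = \<alpha> ^ m * poch (q / \<alpha>) m * poch (1 / q ^ m) m"
proof (induction m)
  case 0
  then show ?case by simp
next
  case (Suc m)
  have left: "poch (x / q ^ Suc m) (Suc m) = (1 - x / q ^ Suc m) * poch (x / q ^ m) m" for x
    using q_nz by (simp add: poch_Suc_left)
  have "(1 - \<alpha> / q ^ Suc m) * (1 - q ^ Suc m) = \<alpha> * (1 - q ^ Suc m / \<alpha>) * (1 - 1 / q ^ Suc m)"
    using q_nz assms by (simp add: field_simps)
  then have "poch (\<alpha> / q ^ Suc m) (Suc m) * poch q (Suc m)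
      = (\<alpha> * (1 - q ^ Suc m / \<alpha>) * (1 - 1 / q ^ Suc m)) * (poch (\<alpha> / q ^ m) m * poch q m)"
    unfolding left poch_Suc[of q] by simp
  also have "\<dots> = \<alpha> ^ Suc m * poch (q / \<alpha>) (Suc m) * poch (1 / q ^ Suc m) (Suc m)"
    unfolding left poch_Suc[of "q / \<alpha>"] Suc.IH by simp
  finally show ?case .
qed

text \<open>With \<open>X = 1/w\<close> this is the part of the integrand for \<open>f = q\<^sup>-\<^sup>n\<close> that has poles inside the circle.
In the induction step the new factor is split against each of the old denominators. This produces the new coefficients for
\<open>k \<le> n\<close>, and the sum of all remaining contributions to the new pole is evaluated with the induction
hypothesis at that pole, \<open>X = q\<^sup>-\<^sup>n\<^sup>-\<^sup>1\<close>.\<close>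

lemma poch_partial_fractions:
  assumes \<alpha>: "\<alpha> \<noteq> 0" and X: "\<And>k. k \<le> n \<Longrightarrow> q ^ k * X \<noteq> 1"
  shows "poch (\<alpha> * X) n / poch X (Suc n)
    = (\<Sum>k\<le>n. \<alpha> ^ k * poch (q / \<alpha>) k * poch \<alpha> (n - k) / (poch q k * poch q (n - k)) / (1 - q ^ k * X))"
  using X
proof (induction n arbitrary: X)
  case 0
  then show ?case by (simp add: poch_Suc)
next
  case (Suc n)
  define C where "C = (\<lambda>n k. \<alpha> ^ k * poch (q / \<alpha>) k * poch \<alpha> (n - k) / (poch q k * poch q (n - k)))"
  define Y where "Y = 1 / q ^ Suc n"
  have Y: "q ^ k * Y \<noteq> 1" if "k \<le> n" for k
  proof
    assume "q ^ k * Y = 1"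
    moreover have "q ^ Suc n = q ^ k * q ^ (Suc n - k)"
      using that by (metis le_SucI le_add_diff_inverse power_add)
    ultimately have "q ^ (Suc n - k) = 1"
      using q_nz by (simp add: Y_def)
    with q_power_neq_1[of "Suc n - k"] that show False by simp
  qed
  have split: "C n k / (1 - q ^ k * X) * ((1 - \<alpha> * X * q ^ n) / (1 - X * q ^ Suc n))
      = C (Suc n) k / (1 - q ^ k * X) + C n k / (1 - q ^ k * Y) * ((1 - \<alpha> / q) / (1 - q ^ Suc n * X))"
    if "k \<le> n" for k
  proof -
    obtain m where m: "n = k + m" using le_Suc_ex[OF \<open>k \<le> n\<close>] by blast
    define u v where "u = q ^ k" and "v = q ^ m"
    have nz: "1 - q * v \<noteq> 0" "1 - u * X \<noteq> 0" "1 - u * (q * v) * X \<noteq> 0" "u \<noteq> 0" "v \<noteq> 0" "poch q m \<noteq> 0"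
      using q_power_neq_1[of "Suc m"] Suc.prems[of k] Suc.prems[of "Suc n"] that q_nz poch_q_nz
      by (auto simp: u_def v_def m power_add mult_ac)
    have CS: "C (Suc n) k = C n k * ((1 - \<alpha> * v) / (1 - q * v))"
      using nz(1) by (simp add: C_def m Suc_diff_le poch_Suc v_def mult.assoc)
    have den: "1 - q ^ k * Y = - ((1 - q * v) / (q * v))"
      using q_nz nz by (simp add: Y_def m power_add u_def[symmetric] v_def[symmetric] field_simps)
    have pow: "q ^ k = u" "q ^ n = u * v" "q ^ Suc n = u * (q * v)"
      by (simp_all add: m power_add u_def v_def)
    have "(1 - \<alpha> * X * (u * v)) * (1 - q * v)
          = (1 - \<alpha> * v) * (1 - u * (q * v) * X) - (q - \<alpha>) * v * (1 - u * X)"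
      by (simp add: algebra_simps)
    moreover have "c / b * (N / d) = c * (s / p) / b + c / - (p / (q * v)) * ((1 - \<alpha> / q) / d)"
      if "N * p = s * d - (q - \<alpha>) * v * b" "p \<noteq> 0" "b \<noteq> 0" "d \<noteq> 0" for N b d s p c :: complex
    proof -
      have "1 - \<alpha> / q = (q - \<alpha>) / q"
        using q_nz by (simp add: diff_divide_distrib)
      then have "c / - (p / (q * v)) * ((1 - \<alpha> / q) / d) = - (c * ((q - \<alpha>) * v)) / (p * d)"
        using q_nz nz(5) by simp
      moreover have "c / b * (N / d) = c * (N * p) / (b * d * p)"
        using that(2) by simp
      moreover have "c * (s * d - w * b) / (b * d * p) = c * (s / p) / b + - (c * w) / (p * d)" for w
        using that(2-4) by (simp add: field_simps)
      ultimately show ?thesis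
        unfolding that(1) by metis
    qed
    ultimately show ?thesis
      unfolding CS den unfolding pow using nz by (simp add: mult.commute[of X])
  qed
  have "poch (\<alpha> * X) (Suc n) / poch X (Suc (Suc n))
      = poch (\<alpha> * X) n / poch X (Suc n) * ((1 - \<alpha> * X * q ^ n) / (1 - X * q ^ Suc n))"
    by (simp only: poch_Suc times_divide_times_eq)
  also have "\<dots> = (\<Sum>k\<le>n. C n k / (1 - q ^ k * X) * ((1 - \<alpha> * X * q ^ n) / (1 - X * q ^ Suc n)))"
  proof -
    have "poch (\<alpha> * X) n / poch X (Suc n) = (\<Sum>k\<le>n. C n k / (1 - q ^ k * X))"
      using Suc.IH[of X] Suc.prems by (simp add: C_def)
    then show ?thesis by (simp only: sum_distrib_right)
  qed
  also have "\<dots> = (\<Sum>k\<le>n. C (Suc n) k / (1 - q ^ k * X))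
      + (\<Sum>k\<le>n. C n k / (1 - q ^ k * Y)) * ((1 - \<alpha> / q) / (1 - q ^ Suc n * X))"
    unfolding sum_distrib_right sum.distrib[symmetric] by (intro sum.cong refl split) auto
  also have "(\<Sum>k\<le>n. C n k / (1 - q ^ k * Y)) = poch (\<alpha> * Y) n / poch Y (Suc n)"
    using Suc.IH[of Y] Y by (simp add: C_def)
  also have "poch (\<alpha> * Y) n / poch Y (Suc n) * ((1 - \<alpha> / q) / (1 - q ^ Suc n * X))
      = C (Suc n) (Suc n) / (1 - q ^ Suc n * X)"
  proof -
    have "poch (\<alpha> * Y) n * (1 - \<alpha> / q) = poch (\<alpha> * Y) (Suc n)"
      using q_nz by (simp add: poch_Suc Y_def)
    moreover have "poch Y (Suc n) \<noteq> 0"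
      using Y by (auto simp: poch_eq_0_iff less_Suc_eq_le mult.commute)
    moreover have "poch (\<alpha> * Y) (Suc n) * poch q (Suc n) = \<alpha> ^ Suc n * poch (q / \<alpha>) (Suc n) * poch Y (Suc n)"
      using poch_reflect_ratio[OF \<alpha>, of "Suc n"] by (simp add: Y_def)
    ultimately have "poch (\<alpha> * Y) n * (1 - \<alpha> / q) / poch Y (Suc n) = C (Suc n) (Suc n)"
      using poch_q_nz[of "Suc n"] by (simp add: C_def divide_simps mult_ac)
    then have "poch (\<alpha> * Y) n / poch Y (Suc n) * (1 - \<alpha> / q) = C (Suc n) (Suc n)"
      by simp
    then show ?thesis by (metis times_divide_eq_right)
  qed
  finally show ?case
    by (simp add: C_def)
qed

end

text \<open>Cauchy's integral formula on the unit circle with the parametrisation that starts at \<open>- \<pi>\<close>; the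
substitution \<open>z \<mapsto> - z\<close> leads back to the path that starts at angle \<open>0\<close>. For \<open>p = 0\<close> it is the
mean value property.\<close>

lemma circle_integral_simple_pole:
  fixes f :: "complex \<Rightarrow> complex"
  assumes f: "f holomorphic_on cball 0 1" and p: "norm p < 1"
  shows "((\<lambda>\<psi>. f (exp (\<i> * of_real \<psi>)) / (1 - p / exp (\<i> * of_real \<psi>)))
           has_integral (2 * of_real pi * f p)) {-pi..pi}"
proof -
  let ?g = "\<lambda>z. f (- z) / (z - (- p)) / \<i>"
  have "(\<lambda>z. f (- z)) holomorphic_on cball 0 1"
    using f by (auto intro!: holomorphic_on_compose_gen[of uminus _ f, unfolded o_def] holomorphic_intros)
  then have "((\<lambda>z. f (- z) / (z - (- p))) has_contour_integral (2 * of_real pi * \<i> * f (- (- p)))) (circlepath 0 1)"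
    by (rule Cauchy_integral_circlepath_simple) (use p in simp)
  then have "(?g has_contour_integral (2 * of_real pi * \<i> * f (- (- p)) / \<i>)) (circlepath 0 1)"
    by (rule has_contour_integral_div)
  moreover have "2 * of_real pi * \<i> * f (- (- p)) / \<i> = 2 * of_real pi * f p"
    by simp
  ultimately have "(?g has_contour_integral (2 * of_real pi * f p)) (circlepath 0 1)"
    by metis
  then have "((\<lambda>t. ?g (0 + of_real 1 * cis t) * of_real 1 * \<i> * cis t) has_integral (2 * of_real pi * f p)) {0..2 * pi}"
    unfolding circlepath_def by (subst (asm) has_contour_integral_part_circlepath_iff) auto
  moreover have "?g (0 + of_real 1 * cis t) * of_real 1 * \<i> * cis t
       = f (exp (\<i> * of_real (t + (- pi)))) / (1 - p / exp (\<i> * of_real (t + (- pi))))" for t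
  proof -
    have e: "exp (\<i> * of_real (t + (- pi))) = - cis t"
      by (simp add: cis_conv_exp ring_distribs exp_diff)
    have "cis t + p \<noteq> 0"
      using p by (metis add_eq_0_iff norm_cis norm_minus_cancel less_irrefl)
    then have "1 + p / cis t \<noteq> 0"
      by (simp add: field_simps)
    with \<open>cis t + p \<noteq> 0\<close> show ?thesis
      unfolding e by (simp add: field_simps)
  qed
  ultimately have "((\<lambda>t. f (exp (\<i> * of_real (t + (- pi)))) / (1 - p / exp (\<i> * of_real (t + (- pi)))))
       has_integral (2 * of_real pi * f p)) {0..2 * pi}"
    by simp
  then show ?thesis
    using has_integral_shift_Icc_real[of "\<lambda>\<psi>. f (exp (\<i> * of_real \<psi>)) / (1 - p / exp (\<i> * of_real \<psi>))" "- pi"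
      "2 * of_real pi * f p" 0 "2 * pi"] by (simp add: o_def add.commute)
qed

text \<open>Differentiation under the integral sign: \<open>x\<close> enters only through \<open>x/w\<close>, which stays inside
the disc where \<open>\<Phi>\<close> is holomorphic.\<close>

lemma circle_integral_param_holomorphic:
  fixes \<Phi> K :: "complex \<Rightarrow> complex"
  assumes \<Phi>: "\<Phi> holomorphic_on ball 0 B" and K: "continuous_on (sphere 0 (norm \<rho>)) K" and \<rho>: "\<rho> \<noteq> 0"
  shows "(\<lambda>x. integral {-pi..pi} (\<lambda>\<psi>. let w = \<rho> * exp (\<i> * of_real \<psi>) in \<Phi> (x / w) * K w))
           holomorphic_on ball 0 (norm \<rho> * B)"
proof -
  define w where "w = (\<lambda>\<psi>. \<rho> * exp (\<i> * complex_of_real \<psi>))"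
  have w: "norm (w \<psi>) = norm \<rho>" "w \<psi> \<noteq> 0" for \<psi>
    using \<rho> by (auto simp: w_def norm_mult)
  have inside: "x / w \<psi> \<in> ball 0 B" if "x \<in> ball 0 (norm \<rho> * B)" for x \<psi>
    using that \<rho> by (simp add: norm_divide w field_simps)
  have cont_w: "continuous_on S w" for S
    unfolding w_def by (intro continuous_intros)
  have Kw: "continuous_on S (\<lambda>\<psi>. K (w \<psi>))" for S
    by (rule continuous_on_compose2[OF K cont_w]) (use w in auto)
  have "(\<lambda>x. integral (cbox (-pi) pi) (\<lambda>\<psi>. \<Phi> (x / w \<psi>) * K (w \<psi>))) holomorphic_on ball 0 (norm \<rho> * B)"
  proof (rule leibniz_rule_holomorphic)
    fix x :: complex and t :: real
    assume x: "x \<in> ball 0 (norm \<rho> * B)"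
    have "(\<Phi> has_field_derivative deriv \<Phi> (x / w t)) (at (x / w t))"
      by (rule holomorphic_derivI[OF \<Phi> _ inside[OF x]]) auto
    then have "((\<lambda>x. \<Phi> (x / w t)) has_field_derivative deriv \<Phi> (x / w t) * (1 / w t)) (at x within ball 0 (norm \<rho> * B))"
      by (rule DERIV_chain2) (auto intro!: derivative_eq_intros simp: w)
    then show "((\<lambda>x. \<Phi> (x / w t) * K (w t)) has_field_derivative deriv \<Phi> (x / w t) * (1 / w t) * K (w t))
        (at x within ball 0 (norm \<rho> * B))"
      by (rule DERIV_cmult_right)
  next
    fix x :: complex assume x: "x \<in> ball 0 (norm \<rho> * B)"
    have "continuous_on (cbox (-pi) pi) (\<lambda>t. \<Phi> (x / w t))"
      by (rule continuous_on_compose2[OF holomorphic_on_imp_continuous_on[OF \<Phi>]])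
         (use inside[OF x] w in \<open>auto intro!: continuous_intros cont_w\<close>)
    then show "(\<lambda>t. \<Phi> (x / w t) * K (w t)) integrable_on cbox (-pi) pi"
      by (intro integrable_continuous continuous_intros Kw)
  next
    have "deriv \<Phi> holomorphic_on ball 0 B"
      using \<Phi> by (intro holomorphic_deriv) auto
    then have "continuous_on (ball 0 (norm \<rho> * B) \<times> cbox (-pi) pi) (\<lambda>p. deriv \<Phi> (fst p / w (snd p)))"
      by (rule continuous_on_compose2[OF holomorphic_on_imp_continuous_on])
         (use inside w in \<open>auto intro!: continuous_intros continuous_on_compose2[OF cont_w[of UNIV]]\<close>)
    then show "continuous_on (ball 0 (norm \<rho> * B) \<times> cbox (-pi) pi)
        (\<lambda>(x, t). deriv \<Phi> (x / w t) * (1 / w t) * K (w t))"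
      unfolding split_def using w
      by (intro continuous_intros continuous_on_compose2[OF cont_w[of UNIV]] continuous_on_compose2[OF Kw[of UNIV]]) auto
  qed auto
  then show ?thesis
    by (simp add: w_def Let_def)
qed

section \<open>Weierstrass' three-term relation and the parameter \<open>h\<close>\<close>

text \<open>Near a zero \<open>p\<close> of \<open>T\<close> both functions are divided by \<open>z - p\<close>; what is left of \<open>T\<close> does not vanish at \<open>p\<close>.\<close>

lemma holomorphic_quotient_simple_zeros:
  fixes F T :: "complex \<Rightarrow> complex"
  assumes S: "open S" and F: "F holomorphic_on S" and T: "T holomorphic_on S"
    and simple: "\<And>p. p \<in> S \<Longrightarrow> T p = 0 \<Longrightarrow> F p = 0 \<and> deriv T p \<noteq> 0"
  obtains R where "R holomorphic_on S" "\<And>z. z \<in> S \<Longrightarrow> F z = R z * T z"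
proof
  \<comment> \<open>At the common zeros the value is the one that de l'Hospital's rule prescribes.\<close>
  define R where "R = (\<lambda>z. if T z = 0 then deriv F z / deriv T z else F z / T z)"
  show "F z = R z * T z" if "z \<in> S" for z
    using simple[OF that] by (auto simp: R_def)
  have "R field_differentiable at p" if p: "p \<in> S" for p
  proof -
    define quot where "quot = (\<lambda>G z. if z = p then deriv G p else (G z - G p) / (z - p))"
    have quot: "quot G holomorphic_on S" if "G holomorphic_on S" for G
      unfolding quot_def using that S by (rule pole_lemma_open)
    obtain N D where ND: "N holomorphic_on S" "D holomorphic_on S" "D p \<noteq> 0"
      and R: "\<And>z. z \<in> S \<Longrightarrow> D z \<noteq> 0 \<Longrightarrow> R z = N z / D z"
    proof (cases "T p = 0")
      case False
      show ?thesis by (rule that[of F T]) (use F T False in \<open>auto simp: R_def\<close>)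
    next
      case True
      show ?thesis
      proof (rule that[of "quot F" "quot T"])
        show "R z = quot F z / quot T z" if "z \<in> S" "quot T z \<noteq> 0" for z
          using True simple[OF p True] that by (auto simp: R_def quot_def)
      qed (use quot F T simple[OF p True] in \<open>auto simp: quot_def\<close>)
    qed
    define U where "U = S \<inter> D -` (- {0})"
    have "open U"
      unfolding U_def using ND(2) S by (intro continuous_open_preimage holomorphic_on_imp_continuous_on) auto
    moreover have "(\<lambda>z. N z / D z) holomorphic_on U"
      using ND by (intro holomorphic_on_divide holomorphic_on_subset[where s = S and t = U]) (auto simp: U_def)
    then have "R holomorphic_on U"
      by (rule holomorphic_transform) (use R in \<open>auto simp: U_def\<close>)
    ultimately show ?thesis
      using p ND(3) by (intro holomorphic_on_imp_differentiable_at[of R U]) (auto simp: U_def)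
  qed
  then show "R holomorphic_on S"
    using S by (simp add: holomorphic_on_open field_differentiable_def)
qed

context q_base
begin

lemma q_powi_orbit:
  assumes step: "\<And>z. z \<noteq> 0 \<Longrightarrow> P z \<longleftrightarrow> P (q * z)" and z: "z \<noteq> 0"
  shows "P (q powi k * z) \<longleftrightarrow> P z"
proof (induction k rule: int_induct[where k = 0])
  case base
  then show ?case by simp
next
  case (step1 i)
  then show ?case
    using step[of "q powi i * z"] z q_nz by (simp add: power_int_add mult_ac)
next
  case (step2 i)
  have "q * (q powi (i - 1) * z) = q powi i * z"
    using q_nz by (simp add: power_int_diff)
  then show ?case
    using step[of "q powi (i - 1) * z"] step2 z q_nz by (metis mult_eq_0_iff power_int_eq_0_iff)
qed

lemma q_powi_annulus:
  assumes "z \<noteq> 0"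
  obtains k :: int where "norm q \<le> norm (q powi k * z)" "norm (q powi k * z) \<le> 1"
proof
  define L where "L = ln (norm q)"
  define k where "k = \<lceil>- ln (norm z) / L\<rceil>"
  have L: "L < 0" using q_lt q_nz by (simp add: L_def)
  have ln: "ln (norm (q powi k * z)) = of_int k * L + ln (norm z)"
    using assms q_nz by (simp add: norm_mult norm_power_int ln_mult L_def flip: powr_real_of_int')
  have pos: "norm (q powi k * z) > 0" using assms q_nz by simp
  have "- ln (norm z) / L \<le> of_int k" "of_int k \<le> - ln (norm z) / L + 1"
    unfolding k_def by linarith+
  then have "of_int k * L \<le> - ln (norm z)" "of_int k * L \<ge> - ln (norm z) + L"
    using L by (simp_all add: field_simps)
  then have "ln (norm (q powi k * z)) \<le> ln 1" "ln (norm q) \<le> ln (norm (q powi k * z))"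
    unfolding ln by (simp_all add: L_def)
  then show "norm q \<le> norm (q powi k * z)" "norm (q powi k * z) \<le> 1"
    using pos q_nz by (simp_all add: ln_le_cancel_iff)
qed

text \<open>The quotient \<open>F/T\<close> extends holomorphically to the punctured plane and is invariant under
\<open>z \<mapsto> qz\<close>. Hence it is bounded by its maximum on the annulus \<open>\<bar>q\<bar> \<le> \<bar>z\<bar> \<le> 1\<close>, and its composition with the
exponential function is constant by Liouville's theorem.\<close>

lemma quasi_periodic_proportional:
  assumes F: "F holomorphic_on - {0}" and T: "T holomorphic_on - {0}"
    and shift: "\<And>z. z \<noteq> 0 \<Longrightarrow> F z = m z * F (q * z)" "\<And>z. z \<noteq> 0 \<Longrightarrow> T z = m z * T (q * z)"
      "\<And>z. z \<noteq> 0 \<Longrightarrow> m z \<noteq> 0"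
    and simple: "\<And>p. p \<noteq> 0 \<Longrightarrow> T p = 0 \<Longrightarrow> F p = 0 \<and> deriv T p \<noteq> 0"
  obtains C where "\<And>z. z \<noteq> 0 \<Longrightarrow> F z = C * T z"
proof -
  obtain R where R: "R holomorphic_on - {0}" "\<And>z. z \<in> - {0} \<Longrightarrow> F z = R z * T z"
    using holomorphic_quotient_simple_zeros[of "- {0}" F T] F T simple by auto
  have per: "R (q * z) = R z" if z: "z \<noteq> 0" for z
  proof -
    \<comment> \<open>The zeros of \<open>T\<close> are isolated, so invariance off the zeros extends to the zeros by continuity.\<close>
    have ev: "\<forall>\<^sub>F w in at z. T w \<noteq> 0"
    proof (cases "T z = 0")
      case True
      have "(T has_field_derivative deriv T z) (at z)"
        using T z by (intro holomorphic_derivI[where S = "- {0}"]) auto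
      then have "((\<lambda>w. (T w - T z) / (w - z)) \<longlongrightarrow> deriv T z) (at z)"
        by (simp add: has_field_derivative_iff)
      then have "\<forall>\<^sub>F w in at z. (T w - T z) / (w - z) \<noteq> 0"
        using simple[OF z True] by (intro tendsto_imp_eventually_ne) auto
      then show ?thesis by eventually_elim (auto simp: True)
    next
      case False
      have "isCont T z"
        using holomorphic_on_imp_continuous_on[OF T] z continuous_on_eq_continuous_at[of "- {0}" T] by auto
      then show ?thesis
        using False by (intro tendsto_imp_eventually_ne) (auto simp: isCont_def)
    qed
    have "\<forall>\<^sub>F w in at z. w \<noteq> 0"
      using z by (intro tendsto_imp_eventually_ne[OF tendsto_ident_at])
    with ev have "\<forall>\<^sub>F w in at z. R (q * w) = R w"
    proof eventually_elim
      case (elim w)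
      then have "m w * T (q * w) * R (q * w) = m w * T (q * w) * R w"
        using R(2)[of w] R(2)[of "q * w"] shift(1,2)[of w] q_nz by (simp add: mult_ac)
      then show ?case
        using elim shift(2)[of w] by auto
    qed
    moreover have "isCont (\<lambda>w. R (q * w)) z" "isCont R z"
    proof -
      have *: "continuous_on (- {0}) R" using R(1) by (rule holomorphic_on_imp_continuous_on)
      have "continuous_on (- {0}) (\<lambda>w. R (q * w))"
        by (rule continuous_on_compose2[OF *]) (use q_nz in \<open>auto intro!: continuous_intros\<close>)
      with * show "isCont (\<lambda>w. R (q * w)) z" "isCont R z"
        using z continuous_on_eq_continuous_at[of "- {0::complex}"] by auto
    qed
    ultimately have "(R \<longlongrightarrow> R (q * z)) (at z)" "(R \<longlongrightarrow> R z) (at z)"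
      using tendsto_cong[of "\<lambda>w. R (q * w)" R "at z"] by (auto simp: isCont_def)
    then show ?thesis
      by (rule tendsto_unique[OF trivial_limit_at])
  qed
  define A where "A = {z :: complex. norm q \<le> norm z} \<inter> cball 0 1"
  have "compact A"
    unfolding A_def by (intro closed_Int_compact closed_Collect_le continuous_intros compact_cball)
  moreover have "continuous_on A R"
    using R(1) q_nz by (intro holomorphic_on_imp_continuous_on holomorphic_on_subset[OF R(1)]) (auto simp: A_def)
  ultimately have "bounded (R ` A)"
    by (intro compact_imp_bounded compact_continuous_image)
  then obtain B where B: "\<And>z. z \<in> A \<Longrightarrow> norm (R z) \<le> B"
    by (auto simp: bounded_iff)
  have bound: "norm (R z) \<le> B" if z: "z \<noteq> 0" for z
  proof -
    obtain k :: int where "norm q \<le> norm (q powi k * z)" "norm (q powi k * z) \<le> 1"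
      using q_powi_annulus[OF z] by blast
    then have "norm (R (q powi k * z)) \<le> B"
      by (intro B) (auto simp: A_def)
    then show ?thesis
      using q_powi_orbit[of "\<lambda>z. norm (R z) \<le> B" z k] z per by simp
  qed
  have "(R \<circ> exp) holomorphic_on UNIV"
    by (rule holomorphic_on_compose_gen[OF _ R(1)]) (auto intro: holomorphic_intros)
  moreover have "bounded (range (R \<circ> exp))"
    using bound by (intro boundedI[of _ B]) auto
  ultimately have const: "(R \<circ> exp) constant_on UNIV"
    by (rule Liouville_theorem)
  then obtain C where C: "\<And>u. R (exp u) = C"
    by (auto simp: constant_on_def)
  show ?thesis
  proof (rule that[of C])
    fix z :: complex assume z: "z \<noteq> 0"
    then show "F z = C * T z"
      using R(2)[of z] C[of "Ln z"] by simp
  qed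
qed

text \<open>At \<open>x = 1\<close> the derivative is \<open>- (q)\<^sub>\<infinity>\<^sup>2\<close>. Differentiating the functional equation transports this to
all other zeros \<open>q\<^sup>k\<close>.\<close>

lemma theta_zeros_simple:
  assumes x: "x \<noteq> 0" and "theta x = 0"
  shows "deriv theta x \<noteq> 0"
proof -
  have diff: "theta field_differentiable at z" if "z \<noteq> 0" for z
    using that by (intro holomorphic_on_imp_differentiable_at[of _ "- {0}"])
                  (auto intro!: holomorphic_intros)
  have step: "theta z = 0 \<and> deriv theta z \<noteq> 0 \<longleftrightarrow> theta (q * z) = 0 \<and> deriv theta (q * z) \<noteq> 0"
    if z: "z \<noteq> 0" for z
  proof (cases "theta z = 0")
    case True
    have "((\<lambda>z. theta (q * z) * z) has_field_derivative
            deriv theta (q * z) * q * z + theta (q * z)) (at z)"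
      using DERIV_chain2[where f = theta and g = "\<lambda>z. q * z",
          OF field_differentiable_derivI[OF diff[of "q * z"]], of q UNIV] z q_nz
      by (auto intro!: derivative_eq_intros)
    moreover have "((\<lambda>z. theta (q * z) * z) has_field_derivative - deriv theta z) (at z)"
    proof (rule has_field_derivative_transform_within_open[of "\<lambda>z. - theta z" _ _ "- {0}"])
      show "((\<lambda>z. - theta z) has_field_derivative - deriv theta z) (at z)"
        using field_differentiable_derivI[OF diff[OF z]] by (rule DERIV_minus)
    qed (use z theta_shift in auto)
    ultimately have "deriv theta (q * z) * q * z + theta (q * z) = - deriv theta z"
      by (rule DERIV_unique)
    then show ?thesis
      using True theta_shift[OF z] q_nz z by auto
  next
    case False
    then show ?thesis using theta_shift[OF z] z by simp
  qed
  have "theta z = (1 - z) * (pinf (q * z) * pinf (q / z))" for z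
    by (simp add: theta_eq pinf_split[of z 1] poch_Suc mult.commute[of z])
  moreover have "((\<lambda>z. (1 - z) * (pinf (q * z) * pinf (q / z))) has_field_derivative - (pinf q * pinf q)) (at 1)"
  proof -
    have "(\<lambda>z. pinf (q * z) * pinf (q / z)) field_differentiable at 1"
      by (intro holomorphic_on_imp_differentiable_at[of _ "- {0}"]) (auto intro!: holomorphic_intros)
    note derivative = field_differentiable_derivI[OF this]
    have "((\<lambda>z. 1 - z) has_field_derivative - 1) (at (1 :: complex))"
      by (auto intro!: derivative_eq_intros)
    from DERIV_mult[OF this derivative] show ?thesis
      by simp
  qed
  ultimately have "deriv theta 1 = - (pinf q * pinf q)"
    by (simp add: DERIV_imp_deriv)
  then have one: "theta 1 = 0 \<and> deriv theta 1 \<noteq> 0"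
    using pinf_nz[OF q_lt] by simp
  obtain k :: int where "x = q powi k"
    using assms theta_eq_0_iff by auto
  then show ?thesis
    using q_powi_orbit[of "\<lambda>z. theta z = 0 \<and> deriv theta z \<noteq> 0" 1 k] step one by simp
qed

text \<open>Weierstrass' three-term relation. As functions of \<open>h\<close>, the left-hand side \<open>F\<close> and
\<open>T(h) = \<theta>(h/g) \<theta>(hgc)\<close> have the same quasi-periodicity, and \<open>F\<close> vanishes at \<open>h = g\<close> and, by the symmetry \<open>h \<mapsto> 1/(hc)\<close>, at
\<open>h = 1/(gc)\<close>. Modulo powers of \<open>q\<close> these are the zeros of \<open>T\<close>, and they are simple when \<open>\<theta>(g\<^sup>2c) \<noteq> 0\<close>. So
\<open>F\<close> is a constant multiple of \<open>T\<close>, and \<open>h = 1\<close> gives the constant.\<close>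

lemma theta_three_term:
  assumes nz: "g \<noteq> 0" "w \<noteq> 0" "c \<noteq> 0" and h: "h \<noteq> 0"
    and generic: "theta g \<noteq> 0" "theta (g * c) \<noteq> 0" "theta (g\<^sup>2 * c) \<noteq> 0"
  shows "theta (h / w) * theta (h * c * w) * (theta g * theta (g * c))
           - theta (g / w) * theta (g * c * w) * (theta h * theta (h * c))
       = g / w * (theta w * theta (c * w)) * (theta (h / g) * theta (h * g * c))"
proof -
  define F where "F = (\<lambda>h. theta (h / w) * theta (h * c * w) * (theta g * theta (g * c))
           - theta (g / w) * theta (g * c * w) * (theta h * theta (h * c)))"
  define T where "T = (\<lambda>h. theta (h / g) * theta (h * g * c))"
  have pair: "theta (x * (q * z)) * theta (y * (q * z)) = theta (x * z) * theta (y * z) / (x * y * z\<^sup>2)"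
    if "x \<noteq> 0" "y \<noteq> 0" "z \<noteq> 0" for x y z
    using theta_shift[of "x * z"] theta_shift[of "y * z"] that
    by (simp add: mult.left_commute[of _ q] power2_eq_square mult_ac)
  have F_shift: "F z = c * z\<^sup>2 * F (q * z)" and T_shift: "T z = c * z\<^sup>2 * T (q * z)" if z: "z \<noteq> 0" for z
  proof -
    have "theta (q * z / w) * theta (q * z * c * w) = theta (z / w) * theta (z * c * w) / (c * z\<^sup>2)"
      "theta (q * z) * theta (q * z * c) = theta z * theta (z * c) / (c * z\<^sup>2)"
      "theta (q * z / g) * theta (q * z * g * c) = theta (z / g) * theta (z * g * c) / (c * z\<^sup>2)"
      using pair[of "1 / w" "c * w" z] pair[of 1 c z] pair[of "1 / g" "g * c" z] nz z
      by (simp_all add: mult_ac)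
    then show "F z = c * z\<^sup>2 * F (q * z)" "T z = c * z\<^sup>2 * T (q * z)"
      using nz z by (simp_all add: F_def T_def right_diff_distrib)
  qed
  have F0: "F (q powi k * z) = 0" if "z \<noteq> 0" "F z = 0" for k z
    using q_powi_orbit[of "\<lambda>z. F z = 0" z k] that F_shift nz by auto
  have F_g: "F g = 0" by (simp add: F_def)
  have F_g': "F (1 / (g * c)) = 0"
  proof -
    have "1 / (g * c) / w = 1 / (g * c * w)" "1 / (g * c) * c * w = 1 / (g / w)" "1 / (g * c) * c = 1 / g"
      using nz by simp_all
    moreover have "theta (1 / (g * c * w)) * theta (1 / (g / w)) = theta (g * c * w) * theta (g / w) / (g\<^sup>2 * c)"
      "theta (1 / (g * c)) * theta (1 / g) = theta (g * c) * theta g / (g\<^sup>2 * c)"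
      using theta_inverse[of "g * c * w"] theta_inverse[of "g / w"] theta_inverse[of "g * c"] theta_inverse[of g] nz
      by (simp_all add: power2_eq_square)
    ultimately show ?thesis
      by (simp only: F_def) simp
  qed
  have simple: "F p = 0 \<and> deriv T p \<noteq> 0" if p: "p \<noteq> 0" "T p = 0" for p
  proof -
    have diff: "theta field_differentiable at z" if "z \<noteq> 0" for z
      using that by (intro holomorphic_on_imp_differentiable_at[of _ "- {0}"])
                    (auto intro!: holomorphic_intros)
    have "((\<lambda>h. theta (h / g)) has_field_derivative deriv theta (p / g) * (1 / g)) (at p)"
      using field_differentiable_derivI[OF diff[of "p / g"]] p nz
      by (intro DERIV_chain2[of theta]) (auto intro!: derivative_eq_intros)
    moreover have "((\<lambda>h. theta (h * g * c)) has_field_derivative deriv theta (p * g * c) * (g * c)) (at p)"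
      using field_differentiable_derivI[OF diff[of "p * g * c"]] p nz
      by (intro DERIV_chain2[of theta]) (auto intro!: derivative_eq_intros)
    ultimately have "deriv T p = deriv theta (p / g) * (1 / g) * theta (p * g * c)
         + deriv theta (p * g * c) * (g * c) * theta (p / g)"
      unfolding T_def by (intro DERIV_imp_deriv DERIV_mult)
    note deriv = this
    consider "theta (p / g) = 0" | "theta (p * g * c) = 0"
      using p by (auto simp: T_def)
    then show ?thesis
    proof cases
      case 1
      then obtain k :: int where "p / g = q powi k"
        using theta_eq_0_iff[of "p / g"] p nz by auto
      then have p_eq: "p = q powi k * g" using nz by (simp add: field_simps)
      have "theta (q powi k * (g\<^sup>2 * c)) \<noteq> 0"
        using q_powi_orbit[of "\<lambda>z. theta z = 0" "g\<^sup>2 * c" k] generic(3) nz theta_shift by auto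
      then have "theta (p * g * c) \<noteq> 0"
        by (simp add: p_eq power2_eq_square mult_ac)
      then show ?thesis
        using deriv 1 theta_zeros_simple[OF _ 1] p nz F0[OF _ F_g] by (simp add: p_eq)
    next
      case 2
      then obtain k :: int where "p * g * c = q powi k"
        using theta_eq_0_iff[of "p * g * c"] p nz by auto
      then have p_eq: "p = q powi k * (1 / (g * c))" using nz by (simp add: field_simps)
      have "theta (q powi k * (1 / (g\<^sup>2 * c))) \<noteq> 0"
        using q_powi_orbit[of "\<lambda>z. theta z = 0" "1 / (g\<^sup>2 * c)" k] generic(3) nz theta_shift theta_inverse[of "g\<^sup>2 * c"]
        by auto
      then have "theta (p / g) \<noteq> 0"
        by (simp add: p_eq power2_eq_square mult_ac)
      then show ?thesis
        using deriv 2 theta_zeros_simple[OF _ 2] p nz F0[OF _ F_g'] by (simp add: p_eq)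
    qed
  qed
  have "F holomorphic_on - {0}" "T holomorphic_on - {0}"
    unfolding F_def T_def using nz by (auto intro!: holomorphic_intros)
  then obtain C where C: "\<And>z. z \<noteq> 0 \<Longrightarrow> F z = C * T z"
    using quasi_periodic_proportional[of F T "\<lambda>z. c * z\<^sup>2"] F_shift T_shift simple nz by auto
  have "C = g / w * (theta w * theta (c * w))"
    using C[of 1] theta_inverse[OF nz(2)] theta_inverse[OF nz(1)] generic nz
    by (simp add: F_def T_def field_simps)
  then show ?thesis
    using C[OF h] by (simp add: F_def T_def)
qed

lemma generic_theta_parameter:
  assumes c: "c \<noteq> 0"
  obtains g where "g \<noteq> 0" "theta g \<noteq> 0" "theta (g * c) \<noteq> 0" "theta (g\<^sup>2 * c) \<noteq> 0"
proof -
  define Z where "Z = insert 0 ((\<Union>k::int. {q powi k, q powi k / c}) \<union> (\<Union>k::int. {g. g\<^sup>2 = q powi k / c}))"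
  have "finite {g::complex. g\<^sup>2 = y}" for y
  proof (rule finite_subset)
    show "{g. g\<^sup>2 = y} \<subseteq> {csqrt y, - csqrt y}"
      by (auto) (metis power2_csqrt power2_eq_iff)
  qed auto
  then have "countable Z"
    unfolding Z_def by (intro countable_insert countable_Un countable_UN) (auto intro: countable_finite)
  then obtain g where "g \<notin> Z"
    using uncountable_UNIV_complex by (metis UNIV_I countable_subset subsetI)
  then show ?thesis
    using that[of g] c theta_eq_0_iff[of g] theta_eq_0_iff[of "g * c"] theta_eq_0_iff[of "g\<^sup>2 * c"]
    by (auto simp: Z_def field_simps)
qed

text \<open>The integral of the theorem with its dependence on \<open>h\<close> displayed; \<open>R\<close> collects the factors that are
holomorphic on the disc of radius \<open>\<bar>\<rho>\<bar>\<close>.\<close>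

definition theta_mean :: "complex \<Rightarrow> complex \<Rightarrow> (complex \<Rightarrow> complex) \<Rightarrow> complex \<Rightarrow> complex" where
  "theta_mean \<rho> c R h = integral {-pi..pi} (\<lambda>\<psi>. let w = \<rho> * exp (\<i> * of_real \<psi>) in
      theta (h / w) * theta (h * c * w) / (pinf (1 / w) * pinf (1 / (c * w))) * R w)"

lemma theta_mean_has_integral:
  assumes \<rho>: "norm \<rho> > 1" "norm (c * \<rho>) > 1" and R: "continuous_on (sphere 0 (norm \<rho>)) R" and h: "h \<noteq> 0"
  shows "((\<lambda>\<psi>. let w = \<rho> * exp (\<i> * of_real \<psi>) in
      theta (h / w) * theta (h * c * w) / (pinf (1 / w) * pinf (1 / (c * w))) * R w)
      has_integral theta_mean \<rho> c R h) {-pi..pi}"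
proof -
  have nz: "c \<noteq> 0" "\<rho> \<noteq> 0" using \<rho> by auto
  have "pinf (1 / (\<rho> * exp (\<i> * of_real \<psi>))) \<noteq> 0" "pinf (1 / (c * (\<rho> * exp (\<i> * of_real \<psi>)))) \<noteq> 0" for \<psi> :: real
    using \<rho> by (auto intro!: pinf_nz simp: norm_mult norm_divide divide_simps)
  moreover have "continuous_on {-pi..pi} (\<lambda>\<psi>. R (\<rho> * exp (\<i> * of_real \<psi>)))"
    by (rule continuous_on_compose2[OF R]) (auto intro!: continuous_intros simp: norm_mult)
  ultimately show ?thesis
    unfolding theta_mean_def Let_def using nz h
    by (intro integrable_integral integrable_continuous_interval continuous_intros) auto
qed

text \<open>The three-term relation turns the difference of the two integrands into a multiple of
\<open>w\<^sup>-\<^sup>1 \<theta>(w) \<theta>(cw) / (1/w, 1/(cw))\<^sub>\<infinity>\<close> times \<open>R(w)\<close>. Since \<open>\<theta>(x)/(1/x)\<^sub>\<infinity> = - x (qx)\<^sub>\<infinity>\<close>, this is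
holomorphic in the disc and vanishes at the centre, so its mean over the circle is \<open>0\<close>.\<close>

lemma theta_mean_proportional_generic:
  assumes \<rho>: "norm \<rho> > 1" "norm (c * \<rho>) > 1" and R: "R holomorphic_on cball 0 (norm \<rho>)"
    and g: "g \<noteq> 0" "theta g \<noteq> 0" "theta (g * c) \<noteq> 0" "theta (g\<^sup>2 * c) \<noteq> 0" and h: "h \<noteq> 0"
  shows "theta_mean \<rho> c R h * (theta g * theta (g * c)) = theta_mean \<rho> c R g * (theta h * theta (h * c))"
proof -
  have nz: "c \<noteq> 0" "\<rho> \<noteq> 0" using \<rho> by auto
  define G where "G = (\<lambda>z. g * c * (theta (h / g) * theta (h * g * c)) * (\<rho> * z)
      * (pinf (q * (\<rho> * z)) * pinf (q * c * (\<rho> * z)) * R (\<rho> * z)))"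
  have cont: "continuous_on (sphere 0 (norm \<rho>)) R"
    using R by (intro holomorphic_on_imp_continuous_on holomorphic_on_subset[OF R]) auto
  have "((\<lambda>\<psi>. let w = \<rho> * exp (\<i> * of_real \<psi>) in
           theta (h / w) * theta (h * c * w) / (pinf (1 / w) * pinf (1 / (c * w))) * R w * (theta g * theta (g * c))
         - theta (g / w) * theta (g * c * w) / (pinf (1 / w) * pinf (1 / (c * w))) * R w * (theta h * theta (h * c)))
      has_integral theta_mean \<rho> c R h * (theta g * theta (g * c)) - theta_mean \<rho> c R g * (theta h * theta (h * c))) {-pi..pi}"
    using has_integral_diff[OF has_integral_mult_left[OF theta_mean_has_integral[OF \<rho> cont h]]
        has_integral_mult_left[OF theta_mean_has_integral[OF \<rho> cont g(1)]]]
    by (simp add: Let_def)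
  moreover have "(let w = \<rho> * exp (\<i> * of_real \<psi>) in
           theta (h / w) * theta (h * c * w) / (pinf (1 / w) * pinf (1 / (c * w))) * R w * (theta g * theta (g * c))
         - theta (g / w) * theta (g * c * w) / (pinf (1 / w) * pinf (1 / (c * w))) * R w * (theta h * theta (h * c)))
       = G (exp (\<i> * of_real \<psi>)) / (1 - 0 / exp (\<i> * of_real \<psi>))" for \<psi> :: real
  proof -
    define w where "w = \<rho> * exp (\<i> * of_real \<psi>)"
    have w: "norm w > 1" "norm (c * w) > 1" using \<rho> by (auto simp: w_def norm_mult)
    then have w0: "w \<noteq> 0" by auto
    have quotient: "theta x / pinf (1 / x) = - x * pinf (q * x)" if x: "norm x > 1" for x
    proof -
      have "x \<noteq> 0" "x \<noteq> 1" using x by auto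
      moreover have "pinf (q / x) \<noteq> 0"
      proof (rule pinf_nz)
        have "norm q < norm x" using q_lt x by simp
        then show "norm (q / x) < 1" using x by (simp add: norm_divide divide_simps)
      qed
      ultimately show ?thesis
        by (simp add: theta_eq pinf_split[of x 1] pinf_split[of "1 / x" 1] poch_Suc mult.commute[of x q] divide_simps)
           (simp add: algebra_simps)
    qed
    define D where "D = pinf (1 / w) * pinf (1 / (c * w))"
    have "theta (h / w) * theta (h * c * w) / D * R w * (theta g * theta (g * c))
         - theta (g / w) * theta (g * c * w) / D * R w * (theta h * theta (h * c))
        = (theta (h / w) * theta (h * c * w) * (theta g * theta (g * c))
           - theta (g / w) * theta (g * c * w) * (theta h * theta (h * c))) / D * R w"
      by (simp add: algebra_simps diff_divide_distrib)
    also have "\<dots> = g / w * (theta w / pinf (1 / w)) * (theta (c * w) / pinf (1 / (c * w)))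
          * (theta (h / g) * theta (h * g * c)) * R w"
      unfolding theta_three_term[OF g(1) w0 nz(1) h g(2-4)] by (simp add: D_def mult.assoc)
    also have "\<dots> = G (exp (\<i> * of_real \<psi>))"
      unfolding quotient[OF w(1)] quotient[OF w(2)] using w0 by (simp add: G_def w_def mult_ac)
    finally show ?thesis
      by (simp add: D_def w_def[symmetric])
  qed
  ultimately have 1: "((\<lambda>\<psi>. G (exp (\<i> * of_real \<psi>)) / (1 - 0 / exp (\<i> * of_real \<psi>))) has_integral
      theta_mean \<rho> c R h * (theta g * theta (g * c)) - theta_mean \<rho> c R g * (theta h * theta (h * c))) {-pi..pi}"
    by simp
  have "(\<lambda>z. R (\<rho> * z)) holomorphic_on cball 0 1"
    by (rule holomorphic_on_compose_gen[OF _ R, of "\<lambda>z. \<rho> * z", unfolded o_def])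
       (auto simp: norm_mult mult_left_le intro!: holomorphic_intros)
  then have "G holomorphic_on cball 0 1"
    unfolding G_def by (intro holomorphic_intros)
  from circle_integral_simple_pole[OF this, of 0]
  have "((\<lambda>\<psi>. G (exp (\<i> * of_real \<psi>)) / (1 - 0 / exp (\<i> * of_real \<psi>))) has_integral 0) {-pi..pi}"
    by (simp add: G_def)
  with 1 have "theta_mean \<rho> c R h * (theta g * theta (g * c)) - theta_mean \<rho> c R g * (theta h * theta (h * c)) = 0"
    by (rule has_integral_unique)
  then show ?thesis by simp
qed

text \<open>Both values are compared with a generic third one, for which nothing degenerates. In this way \<open>g\<close> may
be arbitrary.\<close>

lemma theta_mean_proportional:
  assumes \<rho>: "norm \<rho> > 1" "norm (c * \<rho>) > 1" and R: "R holomorphic_on cball 0 (norm \<rho>)"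
    and nz: "g \<noteq> 0" "h \<noteq> 0"
  shows "theta_mean \<rho> c R h * (theta g * theta (g * c)) = theta_mean \<rho> c R g * (theta h * theta (h * c))"
proof -
  obtain k where k: "k \<noteq> 0" "theta k \<noteq> 0" "theta (k * c) \<noteq> 0" "theta (k\<^sup>2 * c) \<noteq> 0"
    using generic_theta_parameter[of c] \<rho>(2) by (metis mult_zero_left norm_zero not_one_less_zero)
  define t where "t = theta k * theta (k * c)"
  have "theta_mean \<rho> c R x = theta_mean \<rho> c R k * (theta x * theta (x * c)) / t" if "x \<noteq> 0" for x
    using theta_mean_proportional_generic[OF \<rho> R k that] k by (simp add: t_def field_simps)
  then show ?thesis
    using nz by simp
qed

end

section \<open>Analytic continuation in \<open>1/f\<close>\<close>

context q_base
begin

definition vwp_coeff :: "complex \<Rightarrow> complex \<Rightarrow> complex \<Rightarrow> complex \<Rightarrow> complex \<Rightarrow> nat \<Rightarrow> complex" where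
  "vwp_coeff a b c d e k = vwp a k * (poch b k * poch c k * poch d k * poch e k)
     / (poch (a * q / b) k * poch (a * q / c) k * poch (a * q / d) k * poch (a * q / e) k)
     * (a\<^sup>2 * q\<^sup>2 / (b * c * d * e)) ^ k"

text \<open>The term of the very-well-poised series with \<open>x = 1/f\<close>, multiplied by \<open>(aqx)\<^sub>\<infinity>\<close>. The product over
\<open>x - q\<^sup>j\<close> is \<open>(f)\<^sub>k x\<^sup>k\<close>, and the last factor is \<open>(aqx)\<^sub>\<infinity>/(aqx)\<^sub>k\<close>; so the term is entire in \<open>x\<close>, also at
\<open>x = 0\<close>, which corresponds to \<open>f = \<infinity>\<close>.\<close>

definition W_reg_term :: "complex \<Rightarrow> complex \<Rightarrow> complex \<Rightarrow> complex \<Rightarrow> complex \<Rightarrow> complex \<Rightarrow> nat \<Rightarrow> complex" where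
  "W_reg_term a b c d e x k = vwp_coeff a b c d e k * (\<Prod>j<k. x - q ^ j) * pinf (a * q ^ (k + 1) * x)"

definition W_reg :: "complex \<Rightarrow> complex \<Rightarrow> complex \<Rightarrow> complex \<Rightarrow> complex \<Rightarrow> complex \<Rightarrow> complex" where
  "W_reg a b c d e x = (\<Sum>k. W_reg_term a b c d e x k)"

lemma vwp_coeff_bound:
  assumes a: "a \<noteq> 1" and den: "pinf (a * q / b) \<noteq> 0" "pinf (a * q / c) \<noteq> 0" "pinf (a * q / d) \<noteq> 0" "pinf (a * q / e) \<noteq> 0"
  obtains M where "M > 0" "\<And>k. norm (vwp_coeff a b c d e k) \<le> M * norm (a\<^sup>2 * q\<^sup>2 / (b * c * d * e)) ^ k"
proof -
  define r where "r = (\<lambda>k. vwp a k * (poch b k * poch c k * poch d k * poch e k)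
     / (poch (a * q / b) k * poch (a * q / c) k * poch (a * q / d) k * poch (a * q / e) k))"
  have even: "(\<lambda>k. q ^ (2 * k)) \<longlonglongrightarrow> 0"
    unfolding power_mult using q_lt by (intro LIMSEQ_power_zero) (simp add: norm_power power_less_one_iff)
  have "r \<longlonglongrightarrow> (1 - a * 0) * pinf a / ((1 - a) * pinf q) * (pinf b * pinf c * pinf d * pinf e)
     / (pinf (a * q / b) * pinf (a * q / c) * pinf (a * q / d) * pinf (a * q / e))"
    unfolding r_def vwp_def using a den pinf_nz[OF q_lt]
    by (intro tendsto_intros even poch_tendsto_pinf) auto
  then have "Bseq r"
    by (rule convergent_imp_Bseq[OF convergentI])
  then obtain M where "M > 0" "\<And>k. norm (r k) \<le> M"
    by (auto simp: Bseq_def)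
  moreover have "vwp_coeff a b c d e k = r k * (a\<^sup>2 * q\<^sup>2 / (b * c * d * e)) ^ k" for k
    by (simp add: vwp_coeff_def r_def)
  ultimately show ?thesis
    by (intro that[of M]) (simp_all only: norm_mult[of "r _"] norm_power mult_right_mono norm_ge_zero zero_le_power)
qed

text \<open>All factors but finitely many are close to \<open>x\<close>, and the deviations are summable. Hence the product grows
no faster than \<open>R\<^sup>k\<close>, and the series has a geometric majorant up to its full radius of convergence.\<close>

lemma norm_shifted_prod_le:
  assumes R: "R > 0" and x: "norm x \<le> R"
  shows "norm (\<Prod>j<k. x - q ^ j) \<le> exp (1 / (R * (1 - norm q))) * R ^ k"
proof -
  have "norm (\<Prod>j<k. x - q ^ j) \<le> (\<Prod>j<k. R * (1 + norm q ^ j / R))"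
    unfolding prod_norm[symmetric]
  proof (intro prod_mono conjI)
    fix j
    have "norm (x - q ^ j) \<le> norm x + norm (q ^ j)" by (rule norm_triangle_ineq4)
    also have "\<dots> \<le> R * (1 + norm q ^ j / R)" using x R by (simp add: norm_power field_simps)
    finally show "norm (x - q ^ j) \<le> R * (1 + norm q ^ j / R)" .
  qed auto
  also have "\<dots> = R ^ k * (\<Prod>j<k. 1 + norm q ^ j / R)"
    by (simp add: prod.distrib)
  also have "(\<Prod>j<k. 1 + norm q ^ j / R) \<le> exp (\<Sum>j<k. norm q ^ j / R)"
    using R by (intro prod_le_exp_sum) auto
  also have "(\<Sum>j<k. norm q ^ j / R) = (\<Sum>j<k. norm q ^ j) / R"
    by (simp add: sum_divide_distrib)
  also have "(\<Sum>j<k. norm q ^ j) \<le> 1 / (1 - norm q)"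
    using sum_le_suminf[OF summable_geometric[of "norm q"], of "{..<k}"] suminf_geometric[of "norm q"] q_lt by auto
  finally show ?thesis
    using R by (simp add: divide_right_mono mult_left_mono mult_ac)
qed

lemma W_reg_uniform:
  assumes a: "a \<noteq> 1" and den: "pinf (a * q / b) \<noteq> 0" "pinf (a * q / c) \<noteq> 0" "pinf (a * q / d) \<noteq> 0" "pinf (a * q / e) \<noteq> 0"
    and R: "R > 0" "norm (a\<^sup>2 * q\<^sup>2 / (b * c * d * e)) * R < 1"
  shows "uniform_limit (cball 0 R) (\<lambda>n x. \<Sum>k<n. W_reg_term a b c d e x k) (W_reg a b c d e) sequentially"
    and "\<And>x. norm x \<le> R \<Longrightarrow> summable (W_reg_term a b c d e x)"
proof -
  define Y where "Y = norm (a\<^sup>2 * q\<^sup>2 / (b * c * d * e))"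
  obtain M where M: "M > 0" "\<And>k. norm (vwp_coeff a b c d e k) \<le> M * Y ^ k"
    using vwp_coeff_bound[OF a den] unfolding Y_def by blast
  have "bounded (pinf ` cball 0 (norm a * R))"
    by (intro compact_imp_bounded compact_continuous_image continuous_intros compact_cball)
  then obtain B where "\<forall>y\<in>cball 0 (norm a * R). norm (pinf y) \<le> B"
    by (auto simp: bounded_iff)
  then have B: "\<And>y. norm y \<le> norm a * R \<Longrightarrow> norm (pinf y) \<le> B"
    by simp
  define E where "E = exp (1 / (R * (1 - norm q)))"
  have bound: "norm (W_reg_term a b c d e x k) \<le> M * E * B * (Y * R) ^ k" if x: "norm x \<le> R" for x k
  proof -
    have "norm (a * q ^ (k + 1) * x) \<le> norm a * 1 * R"
      unfolding norm_mult norm_power using x q_lt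
      by (intro mult_mono mult_nonneg_nonneg power_le_one) auto
    then have "norm (pinf (a * q ^ (k + 1) * x)) \<le> B"
      by (intro B) simp
    moreover have "norm (\<Prod>j<k. x - q ^ j) \<le> E * R ^ k"
      unfolding E_def by (rule norm_shifted_prod_le[OF R(1) x])
    ultimately have "norm (W_reg_term a b c d e x k) \<le> (M * Y ^ k) * (E * R ^ k) * B"
      unfolding W_reg_term_def norm_mult using M R(1)
      by (intro mult_mono mult_nonneg_nonneg) (auto simp: E_def Y_def)
    then show ?thesis
      by (simp add: power_mult_distrib mult_ac)
  qed
  have sum: "summable (\<lambda>k. M * E * B * (Y * R) ^ k)"
    using R by (intro summable_mult summable_geometric) (auto simp: Y_def abs_mult)
  show "uniform_limit (cball 0 R) (\<lambda>n x. \<Sum>k<n. W_reg_term a b c d e x k) (W_reg a b c d e) sequentially"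
    unfolding W_reg_def by (rule Weierstrass_m_test[OF _ sum]) (use bound in auto)
  show "summable (W_reg_term a b c d e x)" if "norm x \<le> R" for x
    by (rule summable_comparison_test'[OF sum]) (use bound[OF that] in auto)
qed

lemma W_reg_holomorphic:
  assumes a: "a \<noteq> 1" and den: "pinf (a * q / b) \<noteq> 0" "pinf (a * q / c) \<noteq> 0" "pinf (a * q / d) \<noteq> 0" "pinf (a * q / e) \<noteq> 0"
    and R: "R > 0" "norm (a\<^sup>2 * q\<^sup>2 / (b * c * d * e)) * R < 1"
  shows "W_reg a b c d e holomorphic_on ball 0 R"
proof (rule holomorphic_uniform_sequence)
  show "(\<lambda>x. \<Sum>k<n. W_reg_term a b c d e x k) holomorphic_on ball 0 R" for n
    unfolding W_reg_term_def by (intro holomorphic_intros)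
  fix x :: complex assume "x \<in> ball 0 R"
  then obtain r where r: "r > 0" "cball x r \<subseteq> ball 0 R"
    using open_contains_cball[of "ball (0::complex) R"] by (metis open_ball)
  then have "cball x r \<subseteq> cball 0 R"
    using ball_subset_cball by blast
  with r show "\<exists>r>0. cball x r \<subseteq> ball 0 R \<and>
      uniform_limit (cball x r) (\<lambda>n x. \<Sum>k<n. W_reg_term a b c d e x k) (W_reg a b c d e) sequentially"
    using uniform_limit_on_subset[OF W_reg_uniform(1)[OF a den R]] by blast
qed auto

lemma W_reg_sums:
  assumes a: "a \<noteq> 1" and den: "pinf (a * q / b) \<noteq> 0" "pinf (a * q / c) \<noteq> 0" "pinf (a * q / d) \<noteq> 0" "pinf (a * q / e) \<noteq> 0"
    and f: "f \<noteq> 0" "pinf (a * q / f) \<noteq> 0" "norm (a\<^sup>2 * q\<^sup>2 / (b * c * d * e * f)) < 1"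
  shows "(\<lambda>k. vwp a k * (poch b k * poch c k * poch d k * poch e k * poch f k)
     / (poch (a * q / b) k * poch (a * q / c) k * poch (a * q / d) k * poch (a * q / e) k * poch (a * q / f) k)
     * (a\<^sup>2 * q\<^sup>2 / (b * c * d * e * f)) ^ k) sums (W_reg a b c d e (1 / f) / pinf (a * q / f))"
proof -
  have "norm (a\<^sup>2 * q\<^sup>2 / (b * c * d * e)) * norm (1 / f) < 1"
    using f(3) by (simp add: norm_mult norm_divide)
  then have "summable (W_reg_term a b c d e (1 / f))"
    using f(1) by (intro W_reg_uniform(2)[OF a den, of "norm (1 / f)"]) auto
  then have "(\<lambda>k. W_reg_term a b c d e (1 / f) k / pinf (a * q / f)) sums (W_reg a b c d e (1 / f) / pinf (a * q / f))"
    unfolding W_reg_def by (intro sums_divide summable_sums)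
  moreover have "W_reg_term a b c d e (1 / f) k / pinf (a * q / f) = vwp a k * (poch b k * poch c k * poch d k * poch e k * poch f k)
     / (poch (a * q / b) k * poch (a * q / c) k * poch (a * q / d) k * poch (a * q / e) k * poch (a * q / f) k)
     * (a\<^sup>2 * q\<^sup>2 / (b * c * d * e * f)) ^ k" for k
  proof -
    have "(\<Prod>j<k. 1 / f - q ^ j) = (\<Prod>j<k. (1 - f * q ^ j) / f)"
      using f by (intro prod.cong refl) (simp add: field_simps)
    then have 1: "(\<Prod>j<k. 1 / f - q ^ j) = poch f k / f ^ k"
      by (simp add: prod_dividef qpoch_def)
    have 2: "pinf (a * q / f) = poch (a * q / f) k * pinf (a * q ^ (k + 1) * (1 / f))"
      by (subst pinf_split[of _ k]) (simp add: mult_ac)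
    have 3: "(a\<^sup>2 * q\<^sup>2 / (b * c * d * e * f)) ^ k = (a\<^sup>2 * q\<^sup>2 / (b * c * d * e)) ^ k / f ^ k"
      by (simp add: power_divide power_mult_distrib)
    have "pinf (a * q ^ (k + 1) * (1 / f)) \<noteq> 0"
      using f(2) 2 by auto
    then show ?thesis
      unfolding W_reg_term_def vwp_coeff_def 1 2 3 by (simp add: mult_ac)
  qed
  ultimately show ?thesis by simp
qed

text \<open>After division by \<open>(aq/f)\<^sub>\<infinity>\<close> the series is symmetric in all its parameters; singling out \<open>f\<close> was only
needed to continue analytically in \<open>1/f\<close>.\<close>

lemma W_reg_swap:
  assumes "a \<noteq> 1" and "pinf (a * q / b) \<noteq> 0" "pinf (a * q / c) \<noteq> 0" "pinf (a * q / d) \<noteq> 0"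
    and e: "pinf (a * q / e) \<noteq> 0" "e \<noteq> 0" and f: "pinf (a * q / f) \<noteq> 0" "f \<noteq> 0"
    and "norm (a\<^sup>2 * q\<^sup>2 / (b * c * d * e * f)) < 1"
  shows "W_reg a b c d e (1 / f) * pinf (a * q / e) = W_reg a b c d f (1 / e) * pinf (a * q / f)"
proof -
  have "W_reg a b c d e (1 / f) / pinf (a * q / f) = W_reg a b c d f (1 / e) / pinf (a * q / e)"
    using W_reg_sums[of a b c d e f] W_reg_sums[of a b c d f e] assms
    by (simp add: mult_ac sums_iff)
  then show ?thesis
    using e f by (simp add: field_simps)
qed

lemma W_reg_q_power:
  assumes a: "a \<noteq> 1" and nz: "b \<noteq> 0" "c \<noteq> 0" "d \<noteq> 0" "e \<noteq> 0"
    and den: "pinf (a * q / b) \<noteq> 0" "pinf (a * q / c) \<noteq> 0" "pinf (a * q / d) \<noteq> 0" "pinf (a * q / e) \<noteq> 0"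
  shows "W_reg a b c d e (q ^ n) = poch q n * pinf (a * q) / (poch (a * q / d) n * poch (a * q / e) n)
         * (\<Sum>j\<le>n. poch d j * poch e j * poch (a * q / (b * c)) j * poch (a * q / (d * e)) (n - j)
             * (a * q / (d * e)) ^ j
             / (poch q (n - j) * poch q j * poch (a * q / b) j * poch (a * q / c) j))"
proof -
  have poch_nz: "poch x k \<noteq> 0" if "pinf x \<noteq> 0" for x k
    using that pinf_split[of x k] by auto
  have "W_reg_term a b c d e (q ^ n) k = 0" if "k \<notin> {..n}" for k
  proof -
    have "(\<Prod>j<k. q ^ n - q ^ j) = 0" using that by (intro prod_zero) auto
    then show ?thesis by (simp add: W_reg_term_def)
  qed
  then have "W_reg a b c d e (q ^ n) = (\<Sum>k\<le>n. W_reg_term a b c d e (q ^ n) k)"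
    unfolding W_reg_def by (intro suminf_finite) auto
  also have "\<dots> = (\<Sum>r\<le>n. vwp a r * (poch b r * poch c r * poch d r * poch e r)
            / (poch (a * q / b) r * poch (a * q / c) r * poch (a * q / d) r * poch (a * q / e) r)
            * (a\<^sup>2 * q\<^sup>2 / (b * c * d * e)) ^ r * (\<Prod>j<r. q ^ n - q ^ j) * pinf (a * q ^ (n + r + 1)))"
    unfolding W_reg_term_def vwp_coeff_def by (intro sum.cong refl) (simp add: power_add mult_ac)
  also have "\<dots> = poch q n * pinf (a * q) / (poch (a * q / d) n * poch (a * q / e) n)
         * (\<Sum>j\<le>n. poch d j * poch e j * poch (a * q / (b * c)) j * poch (a * q / (d * e)) (n - j)
             * (a * q / (d * e)) ^ j
             / (poch q (n - j) * poch q j * poch (a * q / b) j * poch (a * q / c) j))"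
    by (rule watson_finite) (use a nz den poch_nz in auto)
  finally show ?thesis .
qed

definition watson_kernel :: "complex \<Rightarrow> complex \<Rightarrow> complex \<Rightarrow> complex \<Rightarrow> complex \<Rightarrow> complex \<Rightarrow> complex" where
  "watson_kernel a b c d e w =
     pinf (a * q / (d * e) / w) * pinf (d * e / a * w) * pinf (a * q / b * w) * pinf (a * q / c * w)
     / (pinf (1 / w) * pinf (d * w) * pinf (e * w) * pinf (a * q / (b * c) * w))"

text \<open>The integral for \<open>h = aq/(de)\<close> and \<open>x = 1/f\<close>, as a function that makes sense at \<open>x = 0\<close>. The factor
\<open>\<theta>(hcw) = \<theta>(fw)\<close> has cancelled \<open>(fw)\<^sub>\<infinity>\<close> and leaves \<open>(qx/w)\<^sub>\<infinity>\<close>.\<close>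

definition watson_integral :: "complex \<Rightarrow> complex \<Rightarrow> complex \<Rightarrow> complex \<Rightarrow> complex \<Rightarrow> complex \<Rightarrow> complex \<Rightarrow> complex" where
  "watson_integral \<rho> a b c d e x = integral {-pi..pi} (\<lambda>\<psi>. let w = \<rho> * exp (\<i> * of_real \<psi>) in
      pinf (q * (x / w)) / pinf (a * q / (d * e) * (x / w)) * watson_kernel a b c d e w)"

lemma pinf_scaled_nz:
  assumes "norm (x * \<rho>) < 1" "norm w \<le> norm \<rho>"
  shows "pinf (x * w) \<noteq> 0"
proof (rule pinf_nz)
  have "norm (x * w) \<le> norm (x * \<rho>)"
    unfolding norm_mult using assms(2) by (intro mult_left_mono) auto
  with assms(1) show "norm (x * w) < 1" by simp
qed

lemma watson_integral_holomorphic: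
  assumes nz: "a \<noteq> 0" "d \<noteq> 0" "e \<noteq> 0" and \<rho>: "norm \<rho> > 1"
    and den: "norm (d * \<rho>) < 1" "norm (e * \<rho>) < 1" "norm (a * q / (b * c) * \<rho>) < 1"
  shows "watson_integral \<rho> a b c d e holomorphic_on ball 0 (norm \<rho> * norm (d * e / (a * q)))"
  unfolding watson_integral_def
proof (rule circle_integral_param_holomorphic)
  have "pinf (a * q / (d * e) * y) \<noteq> 0" if "y \<in> ball 0 (norm (d * e / (a * q)))" for y
  proof (rule pinf_nz)
    show "norm (a * q / (d * e) * y) < 1"
      using that nz q_nz by (simp add: norm_mult norm_divide field_simps)
  qed
  then show "(\<lambda>y. pinf (q * y) / pinf (a * q / (d * e) * y)) holomorphic_on ball 0 (norm (d * e / (a * q)))"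
    by (intro holomorphic_intros) auto
  show "continuous_on (sphere 0 (norm \<rho>)) (watson_kernel a b c d e)"
    unfolding watson_kernel_def[abs_def]
  proof (intro continuous_intros ballI)
    fix w :: complex assume "w \<in> sphere 0 (norm \<rho>)"
    then have w: "norm w = norm \<rho>" "w \<noteq> 0" using \<rho> by auto
    have "pinf (1 / w) \<noteq> 0"
      using \<rho> w by (intro pinf_nz) (simp add: norm_divide divide_simps)
    then show "pinf (1 / w) * pinf (d * w) * pinf (e * w) * pinf (a * q / (b * c) * w) \<noteq> 0"
      using pinf_scaled_nz[OF den(1), of w] pinf_scaled_nz[OF den(2), of w] pinf_scaled_nz[OF den(3), of w] w
      by simp
  qed (use \<rho> in auto)
  show "\<rho> \<noteq> 0" using \<rho> by auto
qed

text \<open>For \<open>x = q\<^sup>n\<close> the infinite products in \<open>1/w\<close> reduce to the rational function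
\<open>(\<alpha>/w)\<^sub>n/(1/w)\<^sub>n\<^sub>+\<^sub>1\<close> with \<open>\<alpha> = aq/(de)\<close>: the second sequence of poles \<open>q\<^sup>k/c\<close> has disappeared, and the first one
ends at \<open>q\<^sup>n\<close>.\<close>

lemma watson_integral_q_power:
  assumes nz: "a \<noteq> 0" "b \<noteq> 0" "c \<noteq> 0" "d \<noteq> 0" "e \<noteq> 0" and \<rho>: "norm \<rho> > 1"
    and den: "norm (d * \<rho>) < 1" "norm (e * \<rho>) < 1" "norm (a * q / (b * c) * \<rho>) < 1"
    and n: "norm (a * q / (d * e) * q ^ n) < norm \<rho>"
  shows "watson_integral \<rho> a b c d e (q ^ n) = 2 * of_real pi *
     (\<Sum>k\<le>n. (a * q / (d * e)) ^ k * poch (d * e / a) k * poch (a * q / (d * e)) (n - k) / (poch q k * poch q (n - k))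
        * (pinf (d * e / a * q ^ k) * pinf (a * q / b * q ^ k) * pinf (a * q / c * q ^ k)
           / (pinf (d * q ^ k) * pinf (e * q ^ k) * pinf (a * q / (b * c) * q ^ k))))"
proof -
  define \<alpha> where "\<alpha> = a * q / (d * e)"
  have \<alpha>: "\<alpha> \<noteq> 0" "q / \<alpha> = d * e / a" using nz q_nz by (auto simp: \<alpha>_def)
  have \<rho>0: "\<rho> \<noteq> 0" using \<rho> by auto
  define H where "H = (\<lambda>w. pinf (d * e / a * w) * pinf (a * q / b * w) * pinf (a * q / c * w)
           / (pinf (d * w) * pinf (e * w) * pinf (a * q / (b * c) * w)))"
  define C where "C = (\<lambda>k. \<alpha> ^ k * poch (q / \<alpha>) k * poch \<alpha> (n - k) / (poch q k * poch q (n - k)))"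
  have H: "(\<lambda>z. H (\<rho> * z)) holomorphic_on cball 0 1"
    unfolding H_def
  proof (intro holomorphic_intros)
    fix z :: complex assume "z \<in> cball 0 1"
    then have "norm (\<rho> * z) \<le> norm \<rho>" by (simp add: norm_mult mult_left_le)
    then show "pinf (d * (\<rho> * z)) * pinf (e * (\<rho> * z)) * pinf (a * q / (b * c) * (\<rho> * z)) \<noteq> 0"
      using den by (simp only: pinf_scaled_nz[of _ \<rho>] mult_eq_0_iff simp_thms)
  qed
  have "((\<lambda>\<psi>. \<Sum>k\<le>n. C k * (H (\<rho> * exp (\<i> * of_real \<psi>)) / (1 - q ^ k / \<rho> / exp (\<i> * of_real \<psi>))))
      has_integral (\<Sum>k\<le>n. C k * (2 * of_real pi * H (\<rho> * (q ^ k / \<rho>))))) {-pi..pi}"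
  proof (intro has_integral_sum has_integral_mult_right circle_integral_simple_pole[OF H])
    fix k
    have "norm (q ^ k) \<le> 1" using q_lt by (simp add: norm_power power_le_one)
    then show "norm (q ^ k / \<rho>) < 1" using \<rho> by (simp add: norm_divide divide_simps)
  qed auto
  moreover have "(\<Sum>k\<le>n. C k * (H (\<rho> * exp (\<i> * of_real \<psi>)) / (1 - q ^ k / \<rho> / exp (\<i> * of_real \<psi>))))
     = (let w = \<rho> * exp (\<i> * of_real \<psi>) in
      pinf (q * (q ^ n / w)) / pinf (a * q / (d * e) * (q ^ n / w)) * watson_kernel a b c d e w)" for \<psi> :: real
  proof -
    define w where "w = \<rho> * exp (\<i> * of_real \<psi>)"
    have w: "norm w = norm \<rho>" "w \<noteq> 0" using \<rho>0 by (auto simp: w_def norm_mult)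
    have X: "q ^ k * (1 / w) \<noteq> 1" for k
    proof
      assume "q ^ k * (1 / w) = 1"
      then have "w = q ^ k" using w by (simp add: field_simps)
      moreover have "norm (q ^ k) \<le> 1" using q_lt by (simp add: norm_power power_le_one)
      ultimately show False using w \<rho> by simp
    qed
    have tail: "pinf (\<alpha> * (q ^ n / w)) \<noteq> 0" "pinf (q * (q ^ n / w)) \<noteq> 0"
    proof -
      have "norm (\<alpha> * (q ^ n / w)) = norm (\<alpha> * q ^ n) / norm \<rho>"
        by (simp add: norm_mult norm_divide w)
      also have "\<dots> < 1"
        using n \<rho>0 unfolding \<alpha>_def by (subst divide_less_eq_1_pos) auto
      finally show "pinf (\<alpha> * (q ^ n / w)) \<noteq> 0"
        by (rule pinf_nz)
      have "norm (q ^ Suc n) \<le> 1"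
        unfolding norm_power using q_lt by (intro power_le_one) auto
      then show "pinf (q * (q ^ n / w)) \<noteq> 0"
        using w \<rho> by (intro pinf_nz) (simp add: norm_mult norm_divide divide_simps)
    qed
    have "pinf (q * (q ^ n / w)) / pinf (\<alpha> * (q ^ n / w)) * (pinf (\<alpha> / w) / pinf (1 / w))
        = poch (\<alpha> * (1 / w)) n / poch (1 / w) (Suc n)"
      using tail by (simp add: pinf_split[of "\<alpha> / w" n] pinf_split[of "1 / w" "Suc n"] mult_ac)
    also have "\<dots> = (\<Sum>k\<le>n. C k / (1 - q ^ k * (1 / w)))"
      unfolding C_def by (rule poch_partial_fractions) (use \<alpha> X in auto)
    finally have fractions: "pinf (q * (q ^ n / w)) / pinf (\<alpha> * (q ^ n / w)) * (pinf (\<alpha> / w) / pinf (1 / w))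
        = (\<Sum>k\<le>n. C k / (1 - q ^ k * (1 / w)))" .
    have "pinf (q * (q ^ n / w)) / pinf (\<alpha> * (q ^ n / w)) * watson_kernel a b c d e w
        = pinf (q * (q ^ n / w)) / pinf (\<alpha> * (q ^ n / w)) * (pinf (\<alpha> / w) / pinf (1 / w)) * H w"
      by (simp add: watson_kernel_def H_def \<alpha>_def[symmetric] mult_ac)
    also have "\<dots> = (\<Sum>k\<le>n. C k / (1 - q ^ k * (1 / w))) * H w"
      unfolding fractions ..
    finally show ?thesis
      by (simp add: w_def[symmetric] \<alpha>_def[symmetric] sum_distrib_right)
  qed
  ultimately have "watson_integral \<rho> a b c d e (q ^ n) = (\<Sum>k\<le>n. C k * (2 * of_real pi * H (\<rho> * (q ^ k / \<rho>))))"
    unfolding watson_integral_def by (simp add: integral_unique)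
  then show ?thesis
    using \<rho>0 by (simp add: C_def H_def \<alpha>(2) \<alpha>_def[symmetric] sum_distrib_left mult_ac)
qed

text \<open>Both sides are holomorphic in the disc \<open>\<bar>aqx/(de)\<bar> < \<bar>\<rho>\<bar>\<close>; the series converges there because
\<open>\<bar>aq\<rho>/(bc)\<bar> < 1\<close>. They agree at the points \<open>q\<^sup>n\<close> of the disc by Watson's transformation, and these accumulate at \<open>0\<close>.\<close>

lemma watson_integral_identity:
  assumes a: "a \<noteq> 1" and nz: "a \<noteq> 0" "b \<noteq> 0" "c \<noteq> 0" "d \<noteq> 0" "e \<noteq> 0" and \<rho>: "norm \<rho> > 1"
    and den: "norm (d * \<rho>) < 1" "norm (e * \<rho>) < 1" "norm (a * q / (b * c) * \<rho>) < 1"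
    and pden: "pinf (a * q / b) \<noteq> 0" "pinf (a * q / c) \<noteq> 0" "pinf (a * q / d) \<noteq> 0" "pinf (a * q / e) \<noteq> 0"
    and x: "norm (a * q / (d * e) * x) < norm \<rho>"
  shows "2 * of_real pi * pinf (d * e / a) * pinf (q * x)
           * (pinf (a * q / b) * pinf (a * q / c) * pinf (a * q / d) * pinf (a * q / e)) * W_reg a b c d e x
       = pinf q * pinf (a * q) * pinf (a * q / (b * c)) * pinf (a * q / d * x) * pinf (a * q / e * x)
           * pinf d * pinf e * watson_integral \<rho> a b c d e x"
proof -
  define R where "R = norm \<rho> * norm (d * e / (a * q))"
  have Rpos: "R > 0" using nz q_nz \<rho> unfolding R_def by (intro mult_pos_pos) auto
  have ball: "y \<in> ball 0 R \<longleftrightarrow> norm (a * q / (d * e) * y) < norm \<rho>" for y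
    using nz q_nz by (simp add: R_def norm_mult norm_divide field_simps)
  define \<Delta> where "\<Delta> = (\<lambda>x. 2 * of_real pi * pinf (d * e / a) * pinf (q * x)
           * (pinf (a * q / b) * pinf (a * q / c) * pinf (a * q / d) * pinf (a * q / e)) * W_reg a b c d e x
       - pinf q * pinf (a * q) * pinf (a * q / (b * c)) * pinf (a * q / d * x) * pinf (a * q / e * x)
           * pinf d * pinf e * watson_integral \<rho> a b c d e x)"
  have "norm (a\<^sup>2 * q\<^sup>2 / (b * c * d * e)) * R = norm (a * q / (b * c) * \<rho>)"
    using nz q_nz by (simp add: R_def norm_mult norm_divide power2_eq_square field_simps)
  then have "W_reg a b c d e holomorphic_on ball 0 R"
    using den by (intro W_reg_holomorphic[OF a pden Rpos]) auto
  moreover have "watson_integral \<rho> a b c d e holomorphic_on ball 0 R"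
    unfolding R_def by (intro watson_integral_holomorphic nz \<rho> den)
  ultimately have hol: "\<Delta> holomorphic_on ball 0 R"
    unfolding \<Delta>_def by (intro holomorphic_intros)
  have zero: "\<Delta> (q ^ n) = 0" if n: "q ^ n \<in> ball 0 R" for n
  proof -
    define \<alpha> where "\<alpha> = a * q / (d * e)"
    define t where "t = (\<lambda>k. poch d k * poch e k * poch (a * q / (b * c)) k * poch \<alpha> (n - k) * \<alpha> ^ k
             / (poch q (n - k) * poch q k * poch (a * q / b) k * poch (a * q / c) k))"
    have small: "norm (y * 1) < 1" if "norm (y * \<rho>) < 1" for y
      using that \<rho> by (metis le_less_trans less_imp_le mult.right_neutral mult_left_mono norm_ge_zero norm_mult norm_one)
    have nz2: "pinf d \<noteq> 0" "pinf e \<noteq> 0" "pinf (a * q / (b * c)) \<noteq> 0"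
      using small[OF den(1)] small[OF den(2)] small[OF den(3)] by (auto intro!: pinf_nz)
    have poch_nz: "poch y k \<noteq> 0" "pinf (y * q ^ k) \<noteq> 0" if "pinf y \<noteq> 0" for y k
      using that pinf_split[of y k] by auto
    have shift: "pinf (y * q ^ k) = pinf y / poch y k" if "pinf y \<noteq> 0" for y k
      using poch_nz[OF that] pinf_split[of y k] by (simp add: field_simps)
    define u where "u = pinf (d * e / a) * (pinf (a * q / b) * pinf (a * q / c))
        / (pinf d * pinf e * pinf (a * q / (b * c)))"
    have residue: "\<alpha> ^ k * poch (d * e / a) k * poch \<alpha> (n - k) / (poch q k * poch q (n - k))
        * (pinf (d * e / a * q ^ k) * pinf (a * q / b * q ^ k) * pinf (a * q / c * q ^ k)
           / (pinf (d * q ^ k) * pinf (e * q ^ k) * pinf (a * q / (b * c) * q ^ k))) = u * t k" for k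
      unfolding shift[OF nz2(1)] shift[OF nz2(2)] shift[OF nz2(3)] shift[OF pden(1)] shift[OF pden(2)] u_def
      by (simp add: t_def pinf_split[of "d * e / a" k] mult_ac)
    have I: "watson_integral \<rho> a b c d e (q ^ n) = 2 * of_real pi * (\<Sum>k\<le>n. u * t k)"
      unfolding residue[symmetric] unfolding \<alpha>_def
      using n ball nz \<rho> den by (intro watson_integral_q_power) auto
    have W: "W_reg a b c d e (q ^ n) = poch q n * pinf (a * q) / (poch (a * q / d) n * poch (a * q / e) n) * (\<Sum>k\<le>n. t k)"
      unfolding t_def \<alpha>_def by (rule W_reg_q_power[OF a nz(2-5) pden])
    have "pinf (q * q ^ n) = pinf q / poch q n" "pinf (a * q / d * q ^ n) = pinf (a * q / d) / poch (a * q / d) n"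
      "pinf (a * q / e * q ^ n) = pinf (a * q / e) / poch (a * q / e) n"
      by (intro shift pden pinf_nz[OF q_lt])+
    then show ?thesis
      unfolding \<Delta>_def I W sum_distrib_left[symmetric] u_def
      using nz2 poch_q_nz[of n] poch_nz[OF pden(3)] poch_nz[OF pden(4)]
      by simp
  qed
  have limpt: "0 islimpt {y. \<exists>n. y = q ^ n \<and> q ^ n \<in> ball 0 R}"
    unfolding islimpt_sequential
  proof -
    obtain N where N: "\<And>n. n \<ge> N \<Longrightarrow> norm (q ^ n) < R"
      using q_powers_tendsto_0 Rpos unfolding LIMSEQ_iff by auto
    have "(\<lambda>n. q ^ (n + N)) \<longlonglongrightarrow> 0"
      using q_powers_tendsto_0 by (rule LIMSEQ_ignore_initial_segment)
    then show "\<exists>s. (\<forall>n. s n \<in> {y. \<exists>n. y = q ^ n \<and> q ^ n \<in> ball 0 R} - {0}) \<and> s \<longlonglongrightarrow> 0"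
      using N q_nz by (intro exI[of _ "\<lambda>n. q ^ (n + N)"]) auto
  qed
  have "\<Delta> y = 0" if "y \<in> {y. \<exists>n. y = q ^ n \<and> q ^ n \<in> ball 0 R}" for y
    using that zero by blast
  moreover have "{y. \<exists>n. y = q ^ n \<and> q ^ n \<in> ball 0 R} \<subseteq> ball 0 R" by blast
  moreover have "0 \<in> ball 0 R" "x \<in> ball 0 R" using Rpos x ball by auto
  ultimately have "\<Delta> x = 0"
    using analytic_continuation[OF hol open_ball connected_ball _ _ limpt, of x] by blast
  then show ?thesis
    by (simp add: \<Delta>_def)
qed

end

section \<open>General parameters\<close>

context q_base
begin

text \<open>The number \<open>c = def/(aq)\<close>, by which the two geometric sequences \<open>q\<^sup>k\<close> and \<open>q\<^sup>k/c\<close> of poles inside the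
circle differ.\<close>

definition pole_ratio :: "complex \<Rightarrow> complex \<Rightarrow> complex \<Rightarrow> complex \<Rightarrow> complex" where
  "pole_ratio a d e f = d * e * f / (a * q)"

definition kernel :: "complex \<Rightarrow> complex \<Rightarrow> complex \<Rightarrow> complex \<Rightarrow> complex \<Rightarrow> complex \<Rightarrow> complex \<Rightarrow> complex" where
  "kernel a b c d e f w = pinf (a * q / b * w) * pinf (a * q / c * w)
     / (pinf (d * w) * pinf (e * w) * pinf (f * w) * pinf (a * q / (b * c) * w))"

text \<open>The condition that the circle of radius \<open>\<bar>\<rho>\<bar>\<close> separates the poles of \<open>(1/w, 1/(cw))\<^sub>\<infinity>\<^sup>-\<^sup>1\<close> from those of
the other denominator factors, in the strong form in which each sequence of poles starts on its side of the circle.\<close>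

definition admissible :: "complex \<Rightarrow> complex \<Rightarrow> complex \<Rightarrow> complex \<Rightarrow> complex \<Rightarrow> complex \<Rightarrow> complex \<Rightarrow> bool" where
  "admissible \<rho> a b c d e f \<longleftrightarrow> norm \<rho> > 1 \<and> norm (pole_ratio a d e f * \<rho>) > 1
     \<and> norm (d * \<rho>) < 1 \<and> norm (e * \<rho>) < 1 \<and> norm (f * \<rho>) < 1 \<and> norm (a * q / (b * c) * \<rho>) < 1"

text \<open>The two sides of the theorem with all denominators cleared, so that they are continuous functions of \<open>f\<close> also
where a theta function vanishes.\<close>

definition series_side :: "complex \<Rightarrow> complex \<Rightarrow> complex \<Rightarrow> complex \<Rightarrow> complex \<Rightarrow> complex \<Rightarrow> complex \<Rightarrow> complex" where
  "series_side h a b c d e f = 2 * of_real pi * (theta h * theta (h * pole_ratio a d e f))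
     * (pinf (a * q / b) * pinf (a * q / c) * pinf (a * q / d) * pinf (a * q / e)) * W_reg a b c d e (1 / f)"

definition integral_side :: "complex \<Rightarrow> complex \<Rightarrow> complex \<Rightarrow> complex \<Rightarrow> complex \<Rightarrow> complex \<Rightarrow> complex \<Rightarrow> complex \<Rightarrow> complex" where
  "integral_side \<rho> h a b c d e f = pinf q * pinf (a * q) * pinf (a * q / (b * c)) * pinf (a * q / (d * e))
     * pinf (a * q / (d * f)) * pinf (a * q / (e * f)) * pinf d * pinf e * pinf f
     * theta_mean \<rho> (pole_ratio a d e f) (kernel a b c d e f) h"

lemma kernel_holomorphic:
  assumes "admissible \<rho> a b c d e f"
  shows "kernel a b c d e f holomorphic_on cball 0 (norm \<rho>)"
  unfolding kernel_def[abs_def]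
proof (intro holomorphic_intros)
  fix w :: complex assume "w \<in> cball 0 (norm \<rho>)"
  then have w: "norm w \<le> norm \<rho>" by simp
  have den: "norm (d * \<rho>) < 1" "norm (e * \<rho>) < 1" "norm (f * \<rho>) < 1" "norm (a * q / (b * c) * \<rho>) < 1"
    using assms by (auto simp: admissible_def)
  show "pinf (d * w) * pinf (e * w) * pinf (f * w) * pinf (a * q / (b * c) * w) \<noteq> 0"
    using den[THEN pinf_scaled_nz, OF w] by simp
qed

text \<open>The first two bounds eliminate \<open>\<rho>\<close> from two of the conditions on the circle; for example \<open>aq/(de) = f/c\<close>,
with \<open>\<bar>f\<rho>\<bar> < 1 < \<bar>c\<rho>\<bar>\<close>. The third one is \<open>1 < \<bar>c\<rho>\<bar>\<close> itself.\<close>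

lemma admissible_products:
  assumes "admissible \<rho> a b c d e f" and nz: "a \<noteq> 0" "d \<noteq> 0" "e \<noteq> 0" "f \<noteq> 0"
  shows "norm f < 1" "norm (a * q / (d * e)) < 1" "norm (a * q / (d * e) * (1 / f)) < norm \<rho>"
proof -
  have \<rho>: "norm \<rho> > 1" "norm (pole_ratio a d e f) * norm \<rho> > 1" "norm f * norm \<rho> < 1"
    using assms(1) by (auto simp: admissible_def norm_mult)
  have "norm f * 1 \<le> norm f * norm \<rho>" using \<rho> by (intro mult_left_mono) auto
  with \<rho> show "norm f < 1" by simp
  have eq: "norm (a * q / (d * e)) * norm (pole_ratio a d e f) = norm f"
    using nz q_nz by (simp add: pole_ratio_def norm_mult norm_divide)
  have "norm (a * q / (d * e)) * 1 \<le> norm (a * q / (d * e)) * (norm (pole_ratio a d e f) * norm \<rho>)"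
    using \<rho> by (intro mult_left_mono) auto
  also have "\<dots> = norm f * norm \<rho>" using eq by simp
  finally show "norm (a * q / (d * e)) < 1" using \<rho> by simp
  have "norm (a * q / (d * e) * (1 / f)) * 1 < norm (a * q / (d * e) * (1 / f)) * (norm (pole_ratio a d e f) * norm \<rho>)"
    using \<rho>(2) nz q_nz by (intro mult_strict_left_mono) auto
  also have "\<dots> = norm \<rho>"
    using nz q_nz by (simp add: pole_ratio_def norm_mult norm_divide)
  finally show "norm (a * q / (d * e) * (1 / f)) < norm \<rho>" by simp
qed

lemma theta_mean_eq_watson_integral:
  assumes adm: "admissible \<rho> a b c d e f" and nz: "a \<noteq> 0" "d \<noteq> 0" "e \<noteq> 0" "f \<noteq> 0"
  shows "theta_mean \<rho> (pole_ratio a d e f) (kernel a b c d e f) (a * q / (d * e))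
       = watson_integral \<rho> a b c d e (1 / f)"
  unfolding theta_mean_def watson_integral_def Let_def
proof (intro integral_cong)
  fix \<psi> :: real
  define w where "w = \<rho> * exp (\<i> * of_real \<psi>)"
  have f: "norm (f * \<rho>) < 1" and "norm \<rho> > 1" using adm by (auto simp: admissible_def)
  then have w: "norm w \<le> norm \<rho>" "w \<noteq> 0" by (auto simp: w_def norm_mult)
  have "pinf (f * w) \<noteq> 0" by (rule pinf_scaled_nz[OF f w(1)])
  moreover have "a * q / (d * e) * pole_ratio a d e f * w = f * w"
      "1 / (pole_ratio a d e f * w) = a * q / (d * e) * (1 / f / w)"
      "q / (a * q / (d * e) / w) = d * e / a * w" "q / (f * w) = q * (1 / f / w)"
    using nz q_nz w by (simp_all add: pole_ratio_def)
  ultimately show "theta (a * q / (d * e) / w) * theta (a * q / (d * e) * pole_ratio a d e f * w)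
      / (pinf (1 / w) * pinf (1 / (pole_ratio a d e f * w))) * kernel a b c d e f w
      = pinf (q * (1 / f / w)) / pinf (a * q / (d * e) * (1 / f / w)) * watson_kernel a b c d e w"
    unfolding theta_eq kernel_def watson_kernel_def by (simp add: mult_ac)
qed

text \<open>For \<open>g = aq/(de)\<close> one has \<open>\<theta>(g) \<theta>(gc) = (g, de/a, f, q/f)\<^sub>\<infinity>\<close>. The transfer from \<open>g\<close> to \<open>h\<close> therefore introduces
the factors \<open>(de/a, q/f)\<^sub>\<infinity>\<close>, which are the ones that must be cancelled.\<close>

lemma sides_eq_generic:
  assumes adm: "admissible \<rho> a b c d e f" and a: "a \<noteq> 1"
    and nz: "a \<noteq> 0" "b \<noteq> 0" "c \<noteq> 0" "d \<noteq> 0" "e \<noteq> 0" "f \<noteq> 0" "h \<noteq> 0"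
    and pden: "pinf (a * q / b) \<noteq> 0" "pinf (a * q / c) \<noteq> 0" "pinf (a * q / d) \<noteq> 0" "pinf (a * q / e) \<noteq> 0"
    and generic: "pinf (d * e / a) \<noteq> 0" "pinf (q / f) \<noteq> 0"
  shows "series_side h a b c d e f = integral_side \<rho> h a b c d e f"
proof -
  define g where "g = a * q / (d * e)"
  define J where "J = theta_mean \<rho> (pole_ratio a d e f) (kernel a b c d e f)"
  define k where "k = theta h * theta (h * pole_ratio a d e f)"
  have g: "g \<noteq> 0" "theta g = pinf g * pinf (d * e / a)" "theta (g * pole_ratio a d e f) = pinf f * pinf (q / f)"
    using nz q_nz by (simp_all add: g_def theta_eq pole_ratio_def)
  have \<rho>: "norm \<rho> > 1" "norm (pole_ratio a d e f * \<rho>) > 1"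
    and den: "norm (d * \<rho>) < 1" "norm (e * \<rho>) < 1" "norm (a * q / (b * c) * \<rho>) < 1"
    using adm by (auto simp: admissible_def)
  have J: "J h * (pinf g * pinf (d * e / a) * (pinf f * pinf (q / f))) = watson_integral \<rho> a b c d e (1 / f) * k"
    using theta_mean_proportional[OF \<rho> kernel_holomorphic[OF adm] g(1) nz(7)]
      theta_mean_eq_watson_integral[OF adm nz(1,4-6)]
    unfolding g by (simp add: J_def k_def g_def)
  have x: "norm (a * q / (d * e) * (1 / f)) < norm \<rho>"
    using admissible_products[OF adm] nz by auto
  have arg: "q * (1 / f) = q / f" "a * q / d * (1 / f) = a * q / (d * f)" "a * q / e * (1 / f) = a * q / (e * f)"
    by simp_all
  define P where "P = pinf q * pinf (a * q) * pinf (a * q / (b * c)) * pinf (a * q / (d * f)) * pinf (a * q / (e * f))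
           * pinf d * pinf e"
  define L where "L = 2 * of_real pi * (pinf (a * q / b) * pinf (a * q / c) * pinf (a * q / d) * pinf (a * q / e))
       * W_reg a b c d e (1 / f)"
  have W: "pinf (d * e / a) * pinf (q / f) * L = P * watson_integral \<rho> a b c d e (1 / f)"
    using watson_integral_identity[OF a nz(1-5) \<rho>(1) den pden x]
    unfolding arg by (simp add: P_def L_def mult_ac)
  have "pinf (d * e / a) * pinf (q / f) * (L * k) = P * (watson_integral \<rho> a b c d e (1 / f) * k)"
    using arg_cong[OF W, of "\<lambda>x. x * k"] by (simp only: mult_ac)
  also have "\<dots> = pinf (d * e / a) * pinf (q / f) * (P * pinf g * pinf f * J h)"
    unfolding J[symmetric] by (simp only: mult_ac)
  finally have "L * k = P * pinf g * pinf f * J h"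
    using generic by simp
  then show ?thesis
    by (simp add: series_side_def integral_side_def L_def k_def P_def J_def g_def mult_ac)
qed

lemma sides_continuous:
  assumes adm: "admissible \<rho> a b c d e f" and a: "a \<noteq> 1"
    and nz: "a \<noteq> 0" "b \<noteq> 0" "c \<noteq> 0" "d \<noteq> 0" "e \<noteq> 0" "f \<noteq> 0" "h \<noteq> 0"
    and pden: "pinf (a * q / b) \<noteq> 0" "pinf (a * q / c) \<noteq> 0" "pinf (a * q / d) \<noteq> 0" "pinf (a * q / e) \<noteq> 0"
  shows "\<forall>\<^sub>F f' in at f. f' \<noteq> 0 \<and> admissible \<rho> a b c d e f'"
    and "isCont (series_side h a b c d e) f" and "isCont (integral_side \<rho> h a b c d e) f"
proof -
  define U where "U = {f'. f' \<noteq> 0 \<and> norm (pole_ratio a d e f' * \<rho>) > 1 \<and> norm (f' * \<rho>) < 1}"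
  have \<rho>: "norm \<rho> > 1" and den: "norm (d * \<rho>) < 1" "norm (e * \<rho>) < 1" "norm (a * q / (b * c) * \<rho>) < 1"
    using adm by (auto simp: admissible_def)
  have adm_U: "admissible \<rho> a b c d e f'" if "f' \<in> U" for f'
    using that \<rho> den by (auto simp: U_def admissible_def)
  have base_cont: "continuous_on S (\<lambda>x. pole_ratio a d e (g x))" if "continuous_on S g" for S and g :: "'x::topological_space \<Rightarrow> complex"
    unfolding pole_ratio_def using that nz q_nz by (intro continuous_intros) auto
  have "open U"
    unfolding U_def
    by (intro open_Collect_conj open_Collect_less open_Collect_neq continuous_intros base_cont)
  have "f \<in> U" using adm nz by (auto simp: U_def admissible_def)
  have "\<forall>\<^sub>F f' in at f. f' \<in> U"
    using \<open>open U\<close> \<open>f \<in> U\<close> by (rule eventually_at_in_open')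
  then show "\<forall>\<^sub>F f' in at f. f' \<noteq> 0 \<and> admissible \<rho> a b c d e f'"
    by eventually_elim (auto simp: adm_U, auto simp: U_def)
  define R where "R = norm \<rho> * norm (d * e / (a * q))"
  have Rpos: "R > 0" using nz q_nz \<rho> unfolding R_def by (intro mult_pos_pos) auto
  have "norm (a\<^sup>2 * q\<^sup>2 / (b * c * d * e)) * R = norm (a * q / (b * c) * \<rho>)"
    using nz q_nz by (simp add: R_def norm_mult norm_divide power2_eq_square field_simps)
  then have "W_reg a b c d e holomorphic_on ball 0 R"
    using den by (intro W_reg_holomorphic[OF a pden Rpos]) auto
  then have W: "continuous_on (ball 0 R) (W_reg a b c d e)"
    by (rule holomorphic_on_imp_continuous_on)
  have inv: "1 / f' \<in> ball 0 R" if "f' \<in> U" for f'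
  proof -
    have "norm (a * q / (d * e) * (1 / f')) < norm \<rho>"
      using admissible_products(3)[OF adm_U[OF that]] nz that by (auto simp: U_def)
    then have "norm (a * q / (d * e) * (1 / f')) * norm (d * e / (a * q)) < R"
      unfolding R_def using nz q_nz by (intro mult_strict_right_mono) auto
    moreover have "norm (a * q / (d * e) * (1 / f')) * norm (d * e / (a * q)) = norm (1 / f')"
      using nz q_nz by (simp add: norm_mult norm_divide)
    ultimately show ?thesis by simp
  qed
  have base_nz: "pole_ratio a d e f' \<noteq> 0" if "f' \<in> U" for f'
    using that by (auto simp: U_def)
  have "continuous_on U (\<lambda>f'. 1 / f')"
    by (intro continuous_intros) (auto simp: U_def)
  then have W': "continuous_on U (\<lambda>f'. W_reg a b c d e (1 / f'))"
    by (rule continuous_on_compose2[OF W]) (use inv in blast)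
  have base: "continuous_on U (pole_ratio a d e)"
    using base_cont[OF continuous_on_id] by simp
  have "continuous_on U (series_side h a b c d e)"
    unfolding series_side_def[abs_def]
    by (intro continuous_intros W' base) (use base_nz nz in auto)
  then show "isCont (series_side h a b c d e) f"
    using \<open>open U\<close> \<open>f \<in> U\<close> by (auto simp: continuous_on_eq_continuous_at)
  define w where "w = (\<lambda>p. \<rho> * exp (\<i> * complex_of_real (snd (p :: complex \<times> real))))"
  have w: "norm (w p) = norm \<rho>" "w p \<noteq> 0" for p
    using \<rho> by (auto simp: w_def norm_mult)
  have cont_w: "continuous_on S w" for S
    unfolding w_def by (intro continuous_intros)
  have nonvanishing: "pole_ratio a d e (fst p) \<noteq> 0"
    "pinf (1 / w p) * pinf (1 / (pole_ratio a d e (fst p) * w p)) \<noteq> 0"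
    "pinf (d * w p) * pinf (e * w p) * pinf (fst p * w p) * pinf (a * q / (b * c) * w p) \<noteq> 0"
    if "p \<in> U \<times> cbox (-pi) pi" for p
  proof -
    have f: "fst p \<in> U" using that by auto
    then show "pole_ratio a d e (fst p) \<noteq> 0" by (rule base_nz)
    have "pinf (1 / w p) \<noteq> 0"
      using \<rho> w[of p] by (intro pinf_nz) (simp add: norm_divide divide_simps)
    moreover have "pinf (1 / (pole_ratio a d e (fst p) * w p)) \<noteq> 0"
      using f w[of p] by (intro pinf_nz) (simp add: U_def norm_divide norm_mult divide_simps)
    ultimately show "pinf (1 / w p) * pinf (1 / (pole_ratio a d e (fst p) * w p)) \<noteq> 0"
      by simp
    have "norm (fst p * \<rho>) < 1" using f by (simp add: U_def)
    from this[THEN pinf_scaled_nz] den[THEN pinf_scaled_nz]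
    show "pinf (d * w p) * pinf (e * w p) * pinf (fst p * w p) * pinf (a * q / (b * c) * w p) \<noteq> 0"
      using w(1)[of p] unfolding mult_eq_0_iff by (metis order_refl)
  qed
  have "continuous_on (U \<times> cbox (-pi) pi) (\<lambda>p. theta (h / w p) * theta (h * pole_ratio a d e (fst p) * w p)
      / (pinf (1 / w p) * pinf (1 / (pole_ratio a d e (fst p) * w p))) * kernel a b c d e (fst p) (w p))"
    unfolding kernel_def
    by (intro continuous_intros cont_w base_cont ballI nonvanishing) (use nz w nonvanishing(1) in auto)
  then have "continuous_on U (\<lambda>f'. integral (cbox (-pi) pi) (\<lambda>\<psi>. let w = \<rho> * exp (\<i> * of_real \<psi>) in
      theta (h / w) * theta (h * pole_ratio a d e f' * w) / (pinf (1 / w) * pinf (1 / (pole_ratio a d e f' * w)))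
        * kernel a b c d e f' w))"
    unfolding Let_def by (intro integral_continuous_on_param) (simp add: split_def w_def)
  then have "continuous_on U (integral_side \<rho> h a b c d e)"
    unfolding integral_side_def[abs_def] theta_mean_def using nz
    by (intro continuous_intros) (auto simp: U_def)
  then show "isCont (integral_side \<rho> h a b c d e) f"
    using \<open>open U\<close> \<open>f \<in> U\<close> by (auto simp: continuous_on_eq_continuous_at)
qed

lemma sides_eq_limit:
  assumes adm: "admissible \<rho> a b c d e f" and a: "a \<noteq> 1"
    and nz: "a \<noteq> 0" "b \<noteq> 0" "c \<noteq> 0" "d \<noteq> 0" "e \<noteq> 0" "f \<noteq> 0" "h \<noteq> 0"
    and pden: "pinf (a * q / b) \<noteq> 0" "pinf (a * q / c) \<noteq> 0" "pinf (a * q / d) \<noteq> 0" "pinf (a * q / e) \<noteq> 0"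
    and ev: "\<forall>\<^sub>F f' in at f. f' \<noteq> 0 \<longrightarrow> admissible \<rho> a b c d e f' \<longrightarrow>
               series_side h a b c d e f' = integral_side \<rho> h a b c d e f'"
  shows "series_side h a b c d e f = integral_side \<rho> h a b c d e f"
proof -
  note cont = sides_continuous[OF adm a nz pden]
  have "\<forall>\<^sub>F f' in at f. series_side h a b c d e f' = integral_side \<rho> h a b c d e f'"
    using ev cont(1) by eventually_elim auto
  then have "(integral_side \<rho> h a b c d e \<longlongrightarrow> series_side h a b c d e f) (at f)"
    using cont(2) unfolding isCont_def by (rule Lim_transform_eventually[rotated])
  then show ?thesis
    using cont(3) unfolding isCont_def by (rule tendsto_unique[OF trivial_limit_at])
qed

lemma pinf_eventually_nz:
  assumes g: "g holomorphic_on S" "open S" "connected S" "p \<in> S" "y \<in> S" "norm (g y) < 1"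
  shows "\<forall>\<^sub>F x in at p. pinf (g x) \<noteq> 0"
proof -
  have "(\<lambda>x. pinf (g x)) holomorphic_on S" using g by (intro holomorphic_intros)
  from non_zero_neighbour_alt[OF this g(2-5)] pinf_nz[OF g(6)] show ?thesis
    by (auto elim: eventually_mono)
qed

lemma sides_eq_nondegenerate_pair:
  assumes adm: "admissible \<rho> a b c d e f" and a: "a \<noteq> 1"
    and nz: "a \<noteq> 0" "b \<noteq> 0" "c \<noteq> 0" "d \<noteq> 0" "e \<noteq> 0" "f \<noteq> 0" "h \<noteq> 0"
    and pden: "pinf (a * q / b) \<noteq> 0" "pinf (a * q / c) \<noteq> 0" "pinf (a * q / d) \<noteq> 0" "pinf (a * q / e) \<noteq> 0"
    and pair: "pinf (d * e / a) \<noteq> 0"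
  shows "series_side h a b c d e f = integral_side \<rho> h a b c d e f"
proof (rule sides_eq_limit[OF adm a nz pden])
  have "\<forall>\<^sub>F f' in at f. pinf (q / f') \<noteq> 0"
    by (rule pinf_eventually_nz[where S = "- {0}" and y = 1])
       (use nz q_lt in \<open>auto intro!: holomorphic_intros connected_punctured_universe\<close>)
  then show "\<forall>\<^sub>F f' in at f. f' \<noteq> 0 \<longrightarrow> admissible \<rho> a b c d e f' \<longrightarrow>
               series_side h a b c d e f' = integral_side \<rho> h a b c d e f'"
    by eventually_elim (use sides_eq_generic a nz pden pair in blast)
qed

lemma sides_swap:
  assumes adm: "admissible \<rho> a b c d e f" and a: "a \<noteq> 1"
    and nz: "a \<noteq> 0" "b \<noteq> 0" "c \<noteq> 0" "d \<noteq> 0" "e \<noteq> 0" "f \<noteq> 0"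
    and pden: "pinf (a * q / b) \<noteq> 0" "pinf (a * q / c) \<noteq> 0" "pinf (a * q / d) \<noteq> 0" "pinf (a * q / e) \<noteq> 0"
      "pinf (a * q / f) \<noteq> 0"
  shows "series_side h a b c d e f = series_side h a b c d f e"
    and "integral_side \<rho> h a b c d e f = integral_side \<rho> h a b c d f e"
proof -
  have "norm (a\<^sup>2 * q\<^sup>2 / (b * c * d * e * f)) < 1"
  proof -
    have \<rho>: "norm (pole_ratio a d e f) * norm \<rho> > 1" "norm (a * q / (b * c)) * norm \<rho> < 1"
      using adm unfolding admissible_def norm_mult[of _ \<rho>] by blast+
    have "norm (a\<^sup>2 * q\<^sup>2 / (b * c * d * e * f)) * 1 \<le> norm (a\<^sup>2 * q\<^sup>2 / (b * c * d * e * f)) * (norm (pole_ratio a d e f) * norm \<rho>)"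
      using \<rho> by (intro mult_left_mono) auto
    also have "\<dots> = norm (a * q / (b * c)) * norm \<rho>"
      using nz q_nz by (simp add: pole_ratio_def norm_mult norm_divide power2_eq_square)
    finally show ?thesis using \<rho> by simp
  qed
  from W_reg_swap[OF a pden(1-4) nz(5) pden(5) nz(6) this]
  have W: "W_reg a b c d e (1 / f) * pinf (a * q / e) = W_reg a b c d f (1 / e) * pinf (a * q / f)" .
  have base: "pole_ratio a d f e = pole_ratio a d e f"
    by (simp add: pole_ratio_def mult_ac)
  define K where "K = 2 * of_real pi * (theta h * theta (h * pole_ratio a d e f))
     * (pinf (a * q / b) * pinf (a * q / c) * pinf (a * q / d))"
  have "series_side h a b c d e f = K * (W_reg a b c d e (1 / f) * pinf (a * q / e))"
    "series_side h a b c d f e = K * (W_reg a b c d f (1 / e) * pinf (a * q / f))"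
    unfolding series_side_def base K_def by (simp_all add: mult_ac)
  then show "series_side h a b c d e f = series_side h a b c d f e"
    using W by simp
  have "kernel a b c d e f = kernel a b c d f e"
    by (intro ext) (simp add: kernel_def mult_ac)
  then show "integral_side \<rho> h a b c d e f = integral_side \<rho> h a b c d f e"
    unfolding integral_side_def base by (simp add: mult_ac)
qed

text \<open>For \<open>f'\<close> near \<open>f\<close> one has \<open>(df'/a)\<^sub>\<infinity> \<noteq> 0\<close>, and the previous case applies with \<open>e\<close> and \<open>f'\<close>
exchanged; there the sides are symmetric in these two parameters.\<close>

theorem sides_eq:
  assumes adm: "admissible \<rho> a b c d e f" and a: "a \<noteq> 1"
    and nz: "a \<noteq> 0" "b \<noteq> 0" "c \<noteq> 0" "d \<noteq> 0" "e \<noteq> 0" "f \<noteq> 0" "h \<noteq> 0"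
    and pden: "pinf (a * q / b) \<noteq> 0" "pinf (a * q / c) \<noteq> 0" "pinf (a * q / d) \<noteq> 0" "pinf (a * q / e) \<noteq> 0"
      "pinf (a * q / f) \<noteq> 0"
  shows "series_side h a b c d e f = integral_side \<rho> h a b c d e f"
proof (rule sides_eq_limit[OF adm a nz pden(1-4)])
  have "\<forall>\<^sub>F f' in at f. pinf (d * f' / a) \<noteq> 0"
    by (rule pinf_eventually_nz[where S = UNIV and y = 0]) (auto intro!: holomorphic_intros simp: nz)
  moreover have "\<forall>\<^sub>F f' in at f. pinf (a * q / f') \<noteq> 0"
    by (rule pinf_eventually_nz[where S = "- {0}" and y = a])
       (use nz q_lt in \<open>auto intro!: holomorphic_intros connected_punctured_universe\<close>)
  ultimately show "\<forall>\<^sub>F f' in at f. f' \<noteq> 0 \<longrightarrow> admissible \<rho> a b c d e f' \<longrightarrow>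
               series_side h a b c d e f' = integral_side \<rho> h a b c d e f'"
  proof eventually_elim
    case (elim f')
    show ?case
    proof (intro impI)
      assume f': "f' \<noteq> 0" and adm': "admissible \<rho> a b c d e f'"
      then have "admissible \<rho> a b c d f' e"
        by (simp add: admissible_def pole_ratio_def mult_ac)
      then have "series_side h a b c d f' e = integral_side \<rho> h a b c d f' e"
        using sides_eq_nondegenerate_pair a nz pden f' elim by blast
      then show "series_side h a b c d e f' = integral_side \<rho> h a b c d e f'"
        using sides_swap[OF adm' a nz(1-5) f' pden(1-4) elim(2)] by simp
    qed
  qed
qed

text \<open>By \<open>(qy)\<^sub>k = (y)\<^sub>k (1 - yq\<^sup>k)/(1 - y)\<close> for \<open>y = \<surd>a\<close> and \<open>y = - \<surd>a\<close>, the square roots occur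
only through \<open>a\<close>.\<close>

lemma W87_eq_vwp_series:
  assumes sa: "\<And>k. poch (csqrt a) k \<noteq> 0" "\<And>k. poch (- csqrt a) k \<noteq> 0"
  shows "W87 a b c d e f q z = (\<Sum>k. vwp a k * (poch b k * poch c k * poch d k * poch e k * poch f k)
     / (poch (a * q / b) k * poch (a * q / c) k * poch (a * q / d) k * poch (a * q / e) k * poch (a * q / f) k)
     * z ^ k)"
proof -
  define r where "r = csqrt a"
  have ra: "r * r = a" by (simp add: r_def flip: power2_eq_square)
  have nz: "1 - r \<noteq> 0" "1 + r \<noteq> 0" "poch r k \<noteq> 0" "poch (- r) k \<noteq> 0" for k
    using sa[of 1] sa[of k] by (auto simp: r_def poch_Suc)
  have shift: "poch (q * y) k = poch y k * (1 - y * q ^ k) / (1 - y)" if "1 - y \<noteq> 0" for y k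
    using poch_Suc_left[of y k] that by (simp add: poch_Suc field_simps)
  have roots: "poch (q * r) k * poch (- (q * r)) k / (poch r k * poch (- r) k) = (1 - a * q ^ (2 * k)) / (1 - a)" for k
  proof -
    have "q ^ (2 * k) = q ^ k * q ^ k"
      by (simp add: mult_2 power_add)
    then have "(1 - r * q ^ k) * (1 + r * q ^ k) = 1 - a * q ^ (2 * k)" "(1 - r) * (1 + r) = 1 - a"
      unfolding ra[symmetric] by (simp_all add: algebra_simps)
    then show ?thesis
      using shift[of r k] shift[of "- r" k] nz by simp
  qed
  have "qpochs [a, q * r, - (q * r), b, c, d, e, f] q k / qpochs (q # W87_denoms a b c d e f q) q k
      = (poch (q * r) k * poch (- (q * r)) k / (poch r k * poch (- r) k)) * (poch a k / poch q k)
        * (poch b k * poch c k * poch d k * poch e k * poch f k)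
        / (poch (a * q / b) k * poch (a * q / c) k * poch (a * q / d) k * poch (a * q / e) k * poch (a * q / f) k)" for k
    by (simp add: qpochs_def W87_denoms_def r_def mult.commute[of q a] mult_ac)
  then show ?thesis
    unfolding W87_def qhyp_def r_def[symmetric] roots vwp_def by simp
qed

end

section \<open>The integral representation\<close>

theorem theorem6p1:
  fixes q a b c d e f h :: complex
    and sq sa sd se sf s t :: complex
    and \<sigma> :: real
  assumes nonzero: "q \<noteq> 0" "a \<noteq> 0" "b \<noteq> 0" "c \<noteq> 0" "d \<noteq> 0" "e \<noteq> 0" "f \<noteq> 0" "h \<noteq> 0"
    and q_less: "norm q < 1"
    and conv: "norm (q^2 * a^2) < norm (b * c * d * e * f)"
    and sigma: "\<sigma> > 0"
    \<comment> \<open>the fixed square roots; \<open>s\<close> is the square root of \<open>def/(qa)\<close>,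
        \<open>t\<close> is \<open>(qa)\<close> to the power 3/2 over the square root of \<open>def\<close>\<close>
    and roots: "sq^2 = q" "sa^2 = a" "sd^2 = d" "se^2 = e" "sf^2 = f"
    and s: "s = sd * se * sf / (sq * sa)"
    and t: "t = (sq * sa)^3 / (sd * se * sf)"
    and hs: "h * s \<notin> {q powi k | k :: int. True}"
    \<comment> \<open>no vanishing denominator factors\<close>
    and series_denoms: "set (W87_denoms a b c d e f q) \<inter> {q powi (- int k) | k :: nat. True} = {}"
    and theta_nz: "qtheta h q \<noteq> 0" "qtheta (h * (d * e * f / (q * a))) q \<noteq> 0"
    and prefactor_nz:
      "\<forall>x \<in> {q * a / b, q * a / c, q * a / d, q * a / e, q * a / f}. qpoch_inf x q \<noteq> 0"
    \<comment> \<open>denominator factors of the integrand\<close>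
    and moduli:
      "norm (of_real \<sigma> * s) < 1"
      "norm (of_real \<sigma> * (1 / s)) < 1"
      "norm (sq * sa * sd / (se * sf)) / \<sigma> < 1"
      "norm (sq * sa * se / (sd * sf)) / \<sigma> < 1"
      "norm (sq * sa * sf / (sd * se)) / \<sigma> < 1"
      "norm (t / (b * c)) / \<sigma> < 1"
  shows "W87 a b c d e f q (q^2 * a^2 / (b * c * d * e * f)) =
    qpochs_inf [q, q * a, q * a / (b * c), q * a / (d * e), q * a / (d * f), q * a / (e * f), d, e, f] q
      / (2 * of_real pi * qthetas [h, h * (d * e * f / (q * a))] q
         * qpochs_inf [q * a / b, q * a / c, q * a / d, q * a / e, q * a / f] q)
    * integral {-pi..pi} (\<lambda>\<psi>. let z = exp (\<i> * of_real \<psi>); u = of_real \<sigma> / z; v = z / of_real \<sigma> in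
        qpochs_inf [h * s * u, q / h * (1 / s) * u,
                    h * s * v, q / h * (1 / s) * v, t / b * v, t / c * v] q
      / qpochs_inf [s * u, 1 / s * u,
                    sq * sa * sd / (se * sf) * v, sq * sa * se / (sd * sf) * v,
                    sq * sa * sf / (sd * se) * v, t / (b * c) * v] q)"
proof -
  interpret q_base q
    using nonzero(1) q_less by unfold_locales
  define \<rho> where "\<rho> = 1 / (of_real \<sigma> * s)"
  have rnz: "sq \<noteq> 0" "sa \<noteq> 0" "sd \<noteq> 0" "se \<noteq> 0" "sf \<noteq> 0" "s \<noteq> 0" "\<sigma> \<noteq> 0" "\<rho> \<noteq> 0"
    using roots nonzero sigma by (auto simp: s \<rho>_def)
  have ratio: "pole_ratio a d e f = s\<^sup>2"
    by (simp add: pole_ratio_def s power_mult_distrib power_divide roots mult.commute[of a])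
  have params: "sq * sa * sd / (se * sf) = d / s" "sq * sa * se / (sd * sf) = e / s" "sq * sa * sf / (sd * se) = f / s"
    "t = q * a / s"
    using rnz unfolding s t roots[symmetric] by (simp_all add: field_simps power2_eq_square power3_eq_cube)

  \<comment> \<open>The moduli conditions on the integrand say precisely that the rescaled circle is admissible.\<close>
  have adm: "admissible \<rho> a b c d e f"
  proof -
    have scale: "norm (x * \<rho>) = norm (x / s) / \<sigma>" for x
      using sigma by (simp add: \<rho>_def norm_mult norm_divide)
    have "norm \<rho> = 1 / norm (of_real \<sigma> * s)" "norm (s\<^sup>2 * \<rho>) = 1 / norm (of_real \<sigma> * (1 / s))"
      using rnz by (simp_all add: \<rho>_def norm_mult norm_divide power2_eq_square)
    moreover have "norm (of_real \<sigma> * s) > 0" "norm (of_real \<sigma> * (1 / s)) > 0"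
      using rnz by simp_all
    ultimately have "norm \<rho> > 1" "norm (s\<^sup>2 * \<rho>) > 1"
      using moduli(1,2) by (simp_all only: less_divide_eq_1_pos)
    moreover have "a * q / (b * c) / s = t / (b * c)"
      by (simp add: params(4) mult_ac)
    then have "norm (a * q / (b * c) * \<rho>) < 1"
      using moduli(6) unfolding scale by metis
    ultimately show ?thesis
      using moduli(3-5) unfolding admissible_def ratio params by (auto simp: scale)
  qed

  have roots_nz: "poch (csqrt a) k \<noteq> 0" "poch (- csqrt a) k \<noteq> 0" for k
  proof -
    have pole_free: "x * q ^ j \<noteq> 1" if "x \<in> set (W87_denoms a b c d e f q)" for x j
    proof
      assume "x * q ^ j = 1"
      then have "x = q powi (- int j)"
        using q_nz by (simp add: power_int_minus field_simps)
      with that series_denoms show False by blast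
    qed
    have "csqrt a \<in> set (W87_denoms a b c d e f q)" "- csqrt a \<in> set (W87_denoms a b c d e f q)"
      by (simp_all add: W87_denoms_def)
    then show "poch (csqrt a) k \<noteq> 0" "poch (- csqrt a) k \<noteq> 0"
      unfolding poch_eq_0_iff using pole_free by blast+
  qed
  have a1: "a \<noteq> 1"
    using roots_nz(1)[of 1] by (auto simp: poch_Suc)
  have pden: "pinf (a * q / b) \<noteq> 0" "pinf (a * q / c) \<noteq> 0" "pinf (a * q / d) \<noteq> 0" "pinf (a * q / e) \<noteq> 0"
      "pinf (a * q / f) \<noteq> 0"
    using prefactor_nz by (simp_all add: mult.commute[of a])

  have "norm (a\<^sup>2 * q\<^sup>2 / (b * c * d * e * f)) < 1"
    using conv nonzero by (simp add: norm_divide norm_mult mult_ac)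
  from W_reg_sums[OF a1 pden(1-4) nonzero(7) pden(5) this]
  have series: "W87 a b c d e f q (q^2 * a^2 / (b * c * d * e * f)) = W_reg a b c d e (1 / f) / pinf (a * q / f)"
    unfolding W87_eq_vwp_series[OF roots_nz] by (simp add: sums_iff mult.commute[of "q\<^sup>2"])

  have integral: "integral {-pi..pi} (\<lambda>\<psi>. let z = exp (\<i> * of_real \<psi>); u = of_real \<sigma> / z; v = z / of_real \<sigma> in
        qpochs_inf [h * s * u, q / h * (1 / s) * u,
                    h * s * v, q / h * (1 / s) * v, t / b * v, t / c * v] q
      / qpochs_inf [s * u, 1 / s * u,
                    sq * sa * sd / (se * sf) * v, sq * sa * se / (sd * sf) * v,
                    sq * sa * sf / (sd * se) * v, t / (b * c) * v] q)
     = theta_mean \<rho> (pole_ratio a d e f) (kernel a b c d e f) h"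
    unfolding theta_mean_def
  proof (intro integral_cong)
    fix \<psi> :: real
    define z where "z = exp (\<i> * complex_of_real \<psi>)"
    define w where "w = \<rho> * z"
    have z: "z \<noteq> 0" and w: "w \<noteq> 0" "w = z / (of_real \<sigma> * s)" using rnz by (auto simp: z_def w_def \<rho>_def)
    \<comment> \<open>In the four numerator factors with \<open>h\<close>, the first and the fourth form \<open>\<theta>(h/w)\<close>, the other two \<open>\<theta>(hcw)\<close>.\<close>
    have u: "h * s * (of_real \<sigma> / z) = h / w" "q / h * (1 / s) * (of_real \<sigma> / z) = q / (h * s\<^sup>2 * w)"
      "s * (of_real \<sigma> / z) = 1 / w" "1 / s * (of_real \<sigma> / z) = 1 / (s\<^sup>2 * w)"
      using rnz z nonzero by (simp_all add: w(2) power2_eq_square)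
    have v: "h * s * (z / of_real \<sigma>) = h * s\<^sup>2 * w" "q / h * (1 / s) * (z / of_real \<sigma>) = q / (h / w)"
      "t / b * (z / of_real \<sigma>) = a * q / b * w" "t / c * (z / of_real \<sigma>) = a * q / c * w"
      "d / s * (z / of_real \<sigma>) = d * w" "e / s * (z / of_real \<sigma>) = e * w" "f / s * (z / of_real \<sigma>) = f * w"
      "t / (b * c) * (z / of_real \<sigma>) = a * q / (b * c) * w"
      using rnz z nonzero by (simp_all add: w(2) params(4) power2_eq_square mult_ac)
    show "(let z = exp (\<i> * of_real \<psi>); u = of_real \<sigma> / z; v = z / of_real \<sigma> in
        qpochs_inf [h * s * u, q / h * (1 / s) * u,
                    h * s * v, q / h * (1 / s) * v, t / b * v, t / c * v] q
      / qpochs_inf [s * u, 1 / s * u,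
                    sq * sa * sd / (se * sf) * v, sq * sa * se / (sd * sf) * v,
                    sq * sa * sf / (sd * se) * v, t / (b * c) * v] q)
      = (let w = \<rho> * exp (\<i> * of_real \<psi>) in
        theta (h / w) * theta (h * pole_ratio a d e f * w) / (pinf (1 / w) * pinf (1 / (pole_ratio a d e f * w)))
          * kernel a b c d e f w)"
      unfolding Let_def params(1-3) z_def[symmetric] w_def[symmetric] u v ratio
      by (simp add: qpochs_inf_def kernel_def theta_eq mult_ac)
  qed

  have "h * pole_ratio a d e f = h * (d * e * f / (q * a))"
    by (simp add: pole_ratio_def mult.commute)
  then have sides: "2 * of_real pi * qthetas [h, h * (d * e * f / (q * a))] q
      * (pinf (a * q / b) * pinf (a * q / c) * pinf (a * q / d) * pinf (a * q / e)) * W_reg a b c d e (1 / f)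
    = qpochs_inf [q, q * a, q * a / (b * c), q * a / (d * e), q * a / (d * f), q * a / (e * f), d, e, f] q
      * theta_mean \<rho> (pole_ratio a d e f) (kernel a b c d e f) h"
    using sides_eq[OF adm a1 nonzero(2-8) pden]
    by (simp add: series_side_def integral_side_def qpochs_inf_def qthetas_def mult_ac)
  have "qthetas [h, h * (d * e * f / (q * a))] q \<noteq> 0"
    using theta_nz by (simp add: qthetas_def)
  then have thetas: "2 * of_real pi * qthetas [h, h * (d * e * f / (q * a))] q \<noteq> 0"
    by simp
  have prefactors: "qpochs_inf [q * a / b, q * a / c, q * a / d, q * a / e, q * a / f] q
      = pinf (a * q / b) * pinf (a * q / c) * pinf (a * q / d) * pinf (a * q / e) * pinf (a * q / f)"
    by (simp add: qpochs_inf_def mult.commute[of q a] mult_ac)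
  have divide: "L / F = N / (T * (P * F)) * J" if "T * P * L = N * J" "T \<noteq> 0" "P \<noteq> 0" for L F N T P J :: complex
    using that by (cases "F = 0") (simp_all add: field_simps)
  show ?thesis
    unfolding series integral prefactors by (rule divide[OF sides thetas]) (use pden in simp)
qed

end
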